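(* Let $M$ be a closed oriented smooth 3-manifold, let $\omega$ be a contact 1-form on $M$ and let $T$ be its Reeb field. Then: (a) $(\ker\omega,T)$ is a critical point of the functional $\mathrm{gv}$; (b) there are no contact structures on $M$ which are extremal for $\mathrm{gv}$; that is, $(\ker\omega,T)$ is never a local extremum of $\mathrm{gv}$.
   Context: A contact form $\omega$ satisfies $\omega\wedge d\omega\neq0$ everywhere; its Reeb field $T$ is determined by $\omega(T)=1$, $\iota_T d\omega=0$. For a plane field $\mathcal D$ and a vector field $T$ transverse to it, let $\omega$ be the unique 1-form with $\ker\omega=\mathcal D$, $\omega(T)=1$, and put $\eta=\iota_T\,d\omega$ and $\mathrm{gv}(\mathcal D,T)=\int_M\eta\wedge d\eta$. Variations of $(\mathcal D,T)$ are smooth families $(\omega_t,T_t)$, $|t|<\varepsilon$, of 1-forms and vector fields with $\omega_t(T_t)\equiv1$, $(\omega_0,T_0)=(\omega,T)$, and $\mathcal D_t=\ker\omega_t$. The pair $(\mathcal D,T)$ is critical if $\frac{d}{dt}\mathrm{gv}(\mathcal D_t,T_t)|_{t=0}=0$ for every variation. It is a local extremum if either for every variation $t\mapsto\mathrm{gv}(\mathcal D_t,T_t)$ has a local minimum at $t=0$, or for every variation it has a local maximum at $t=0$. *)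

theory Defs
  imports "HOL-Analysis.Analysis"
begin

section \<open>Smooth maps between Euclidean spaces\<close>

text \<open>Only meaningful for open \<open>S\<close>: all iterated directional derivatives exist, are
  differentiable, and are continuous on \<open>S\<close>.\<close>

primrec times_differentiable_on ::
  "nat \<Rightarrow> 'a::real_normed_vector set \<Rightarrow> ('a \<Rightarrow> 'b::real_normed_vector) \<Rightarrow> bool" where
  "times_differentiable_on 0 S f \<longleftrightarrow> continuous_on S f"
| "times_differentiable_on (Suc n) S f \<longleftrightarrow>
     (\<forall>x\<in>S. f differentiable (at x)) \<and>
     (\<forall>v. times_differentiable_on n S (\<lambda>x. frechet_derivative f (at x) v))"

definition smooth_on :: "'a::real_normed_vector set \<Rightarrow> ('a \<Rightarrow> 'b::real_normed_vector) \<Rightarrow> bool" where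
  "smooth_on S f \<longleftrightarrow> (\<forall>n. times_differentiable_on n S f)"


section \<open>Closed oriented smooth 3-manifolds\<close>

text \<open>A chart is a pair of its domain and its coordinate map.\<close>

type_synonym 'a chart = "'a set \<times> ('a \<Rightarrow> real^3)"

abbreviation chart_dom :: "'a chart \<Rightarrow> 'a set" where
  "chart_dom c \<equiv> fst c"

abbreviation chart_map :: "'a chart \<Rightarrow> 'a \<Rightarrow> real^3" where
  "chart_map c \<equiv> snd c"

definition chart_range :: "'a chart \<Rightarrow> (real^3) set" where
  "chart_range c = chart_map c ` chart_dom c"

definition chart_inv :: "'a chart \<Rightarrow> real^3 \<Rightarrow> 'a" where
  "chart_inv c = inv_into (chart_dom c) (chart_map c)"

definition overlap :: "'a chart \<Rightarrow> 'a chart \<Rightarrow> (real^3) set" where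
  "overlap c d = chart_map c ` (chart_dom c \<inter> chart_dom d)"

definition transition :: "'a chart \<Rightarrow> 'a chart \<Rightarrow> real^3 \<Rightarrow> real^3" where
  "transition c d = (\<lambda>x. chart_map d (chart_inv c x))"

abbreviation transition_deriv :: "'a chart \<Rightarrow> 'a chart \<Rightarrow> real^3 \<Rightarrow> real^3 \<Rightarrow> real^3" where
  "transition_deriv c d x \<equiv> frechet_derivative (transition c d) (at x)"

definition is_chart :: "'a topology \<Rightarrow> 'a chart \<Rightarrow> bool" where
  "is_chart X c \<longleftrightarrow> openin X (chart_dom c) \<and> open (chart_range c) \<and>
     homeomorphic_map (subtopology X (chart_dom c)) (top_of_set (chart_range c)) (chart_map c)"

text \<open>The atlas \<open>A\<close> need not be maximal; it carries both the smooth structure and the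
  orientation, the latter through the positivity of the Jacobians.\<close>

definition oriented_smooth_atlas :: "'a topology \<Rightarrow> 'a chart set \<Rightarrow> bool" where
  "oriented_smooth_atlas X A \<longleftrightarrow>
     (\<forall>c\<in>A. is_chart X c) \<and> (\<Union>c\<in>A. chart_dom c) = topspace X \<and>
     (\<forall>c\<in>A. \<forall>d\<in>A. smooth_on (overlap c d) (transition c d) \<and>
        (\<forall>x\<in>overlap c d. det (matrix (transition_deriv c d x)) > 0))"

definition closed_oriented_3manifold :: "'a topology \<Rightarrow> 'a chart set \<Rightarrow> bool" where
  "closed_oriented_3manifold X A \<longleftrightarrow>
     Hausdorff_space X \<and> second_countable X \<and> compact_space X \<and> oriented_smooth_atlas X A"


section \<open>Vector fields and differential forms\<close>

text \<open>Tensor fields are given by their local representatives in the charts of the atlas, related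
  by the tensor transformation law on overlaps. The value of a representative in the chart \<open>c\<close> is
  relevant only at points \<open>x \<in> chart_range c\<close>. Throughout, \<open>x\<close> is a point in coordinates and
  \<open>u\<close>, \<open>v\<close>, \<open>w\<close> are tangent vectors at \<open>x\<close> in coordinates.\<close>

type_synonym 'a vec_field = "'a chart \<Rightarrow> real^3 \<Rightarrow> real^3"
type_synonym 'a form1 = "'a chart \<Rightarrow> real^3 \<Rightarrow> real^3 \<Rightarrow> real"
type_synonym 'a form2 = "'a chart \<Rightarrow> real^3 \<Rightarrow> real^3 \<Rightarrow> real^3 \<Rightarrow> real"
type_synonym 'a form3 = "'a chart \<Rightarrow> real^3 \<Rightarrow> real^3 \<Rightarrow> real^3 \<Rightarrow> real^3 \<Rightarrow> real"
type_synonym 'a plane_field = "'a chart \<Rightarrow> real^3 \<Rightarrow> (real^3) set"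

definition vector_field :: "'a chart set \<Rightarrow> 'a vec_field \<Rightarrow> bool" where
  "vector_field A T \<longleftrightarrow>
     (\<forall>c\<in>A. smooth_on (chart_range c) (T c)) \<and>
     (\<forall>c\<in>A. \<forall>d\<in>A. \<forall>x\<in>overlap c d. T d (transition c d x) = transition_deriv c d x (T c x))"

definition one_form :: "'a chart set \<Rightarrow> 'a form1 \<Rightarrow> bool" where
  "one_form A \<omega> \<longleftrightarrow>
     (\<forall>c\<in>A. (\<forall>x\<in>chart_range c. linear (\<omega> c x)) \<and> (\<forall>v. smooth_on (chart_range c) (\<lambda>x. \<omega> c x v))) \<and>
     (\<forall>c\<in>A. \<forall>d\<in>A. \<forall>x\<in>overlap c d. \<forall>v. \<omega> c x v = \<omega> d (transition c d x) (transition_deriv c d x v))"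

definition ext_deriv :: "'a form1 \<Rightarrow> 'a form2" where
  "ext_deriv \<omega> c x u v =
     frechet_derivative (\<lambda>y. \<omega> c y v) (at x) u - frechet_derivative (\<lambda>y. \<omega> c y u) (at x) v"

definition interior_prod :: "'a vec_field \<Rightarrow> 'a form2 \<Rightarrow> 'a form1" where
  "interior_prod T \<beta> c x v = \<beta> c x (T c x) v"

definition wedge12 :: "'a form1 \<Rightarrow> 'a form2 \<Rightarrow> 'a form3" where
  "wedge12 \<alpha> \<beta> c x u v w = \<alpha> c x u * \<beta> c x v w + \<alpha> c x v * \<beta> c x w u + \<alpha> c x w * \<beta> c x u v"

definition ker_form :: "'a form1 \<Rightarrow> 'a plane_field" where
  "ker_form \<omega> c x = {v. \<omega> c x v = 0}"


section \<open>Integration of 3-forms\<close>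

definition smooth_function :: "'a chart set \<Rightarrow> ('a \<Rightarrow> real) \<Rightarrow> bool" where
  "smooth_function A f \<longleftrightarrow> (\<forall>c\<in>A. smooth_on (chart_range c) (\<lambda>x. f (chart_inv c x)))"

text \<open>A finite smooth partition of unity \<open>(\<rho>\<^sub>c)\<close>, \<open>c \<in> F\<close>, subordinate to the atlas.\<close>

definition partition_of_unity ::
  "'a topology \<Rightarrow> 'a chart set \<Rightarrow> 'a chart set \<Rightarrow> ('a chart \<Rightarrow> 'a \<Rightarrow> real) \<Rightarrow> bool" where
  "partition_of_unity X A F \<rho> \<longleftrightarrow> finite F \<and> F \<subseteq> A \<and>
     (\<forall>c\<in>F. smooth_function A (\<rho> c) \<and> (\<forall>p\<in>topspace X. \<rho> c p \<ge> 0) \<and>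
        X closure_of {p \<in> topspace X. \<rho> c p \<noteq> 0} \<subseteq> chart_dom c) \<and>
     (\<forall>p\<in>topspace X. (\<Sum>c\<in>F. \<rho> c p) = 1)"

text \<open>The usual definition by means of a partition of unity. On a closed oriented 3-manifold one
  exists, and for a (continuous) 3-form the result does not depend on which one is chosen.\<close>

definition integral_form :: "'a topology \<Rightarrow> 'a chart set \<Rightarrow> 'a form3 \<Rightarrow> real" where
  "integral_form X A \<mu> =
     (let (F, \<rho>) = (SOME (F, \<rho>). partition_of_unity X A F \<rho>) in
       \<Sum>c\<in>F. LINT x:chart_range c|lborel.
          \<rho> c (chart_inv c x) * \<mu> c x (axis 1 1) (axis 2 1) (axis 3 1))"


section \<open>Contact forms and the functional \<open>gv\<close>\<close>

definition contact_form :: "'a chart set \<Rightarrow> 'a form1 \<Rightarrow> bool" where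
  "contact_form A \<omega> \<longleftrightarrow> one_form A \<omega> \<and>
     (\<forall>c\<in>A. \<forall>x\<in>chart_range c. \<exists>u v w. wedge12 \<omega> (ext_deriv \<omega>) c x u v w \<noteq> 0)"

definition reeb_field :: "'a chart set \<Rightarrow> 'a form1 \<Rightarrow> 'a vec_field \<Rightarrow> bool" where
  "reeb_field A \<omega> T \<longleftrightarrow> vector_field A T \<and>
     (\<forall>c\<in>A. \<forall>x\<in>chart_range c. \<omega> c x (T c x) = 1 \<and>
        (\<forall>v. interior_prod T (ext_deriv \<omega>) c x v = 0))"

text \<open>The unique 1-form with kernel \<open>D\<close> and value \<open>1\<close> on \<open>T\<close>.\<close>

definition form_of :: "'a plane_field \<Rightarrow> 'a vec_field \<Rightarrow> 'a form1" where
  "form_of D T c x = (THE a. linear a \<and> {v. a v = 0} = D c x \<and> a (T c x) = 1)"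

definition gv :: "'a topology \<Rightarrow> 'a chart set \<Rightarrow> 'a plane_field \<Rightarrow> 'a vec_field \<Rightarrow> real" where
  "gv X A D T =
     (let \<eta> = interior_prod T (ext_deriv (form_of D T)) in
       integral_form X A (wedge12 \<eta> (ext_deriv \<eta>)))"

text \<open>A variation of \<open>(D, T)\<close> is a pair of families \<open>(\<omega>\<^sub>t, T\<^sub>t)\<close>, \<open>\<bar>t\<bar> < \<epsilon>\<close>, jointly smooth in the
  parameter \<open>t\<close> and the point of the manifold.\<close>

definition variation ::
  "'a chart set \<Rightarrow> 'a plane_field \<Rightarrow> 'a vec_field \<Rightarrow> real \<Rightarrow>
   (real \<Rightarrow> 'a form1) \<Rightarrow> (real \<Rightarrow> 'a vec_field) \<Rightarrow> bool" where
  "variation A D T \<epsilon> \<omega>t Tt \<longleftrightarrow> \<epsilon> > 0 \<and>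
     (\<forall>t. \<bar>t\<bar> < \<epsilon> \<longrightarrow> one_form A (\<omega>t t) \<and> vector_field A (Tt t)) \<and>
     (\<forall>c\<in>A. (\<forall>v. smooth_on ({-\<epsilon><..<\<epsilon>} \<times> chart_range c) (\<lambda>(t, x). \<omega>t t c x v)) \<and>
        smooth_on ({-\<epsilon><..<\<epsilon>} \<times> chart_range c) (\<lambda>(t, x). Tt t c x)) \<and>
     (\<forall>t. \<bar>t\<bar> < \<epsilon> \<longrightarrow> (\<forall>c\<in>A. \<forall>x\<in>chart_range c. \<omega>t t c x (Tt t c x) = 1)) \<and>
     (\<forall>c\<in>A. \<forall>x\<in>chart_range c. \<omega>t 0 c x = form_of D T c x \<and> Tt 0 c x = T c x)"

definition gv_critical :: "'a topology \<Rightarrow> 'a chart set \<Rightarrow> 'a plane_field \<Rightarrow> 'a vec_field \<Rightarrow> bool" where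
  "gv_critical X A D T \<longleftrightarrow>
     (\<forall>\<epsilon> \<omega>t Tt. variation A D T \<epsilon> \<omega>t Tt \<longrightarrow>
        ((\<lambda>t. gv X A (ker_form (\<omega>t t)) (Tt t)) has_real_derivative 0) (at 0))"

definition local_min_at :: "(real \<Rightarrow> real) \<Rightarrow> real \<Rightarrow> bool" where
  "local_min_at f a \<longleftrightarrow> (\<forall>\<^sub>F t in nhds a. f a \<le> f t)"

definition local_max_at :: "(real \<Rightarrow> real) \<Rightarrow> real \<Rightarrow> bool" where
  "local_max_at f a \<longleftrightarrow> (\<forall>\<^sub>F t in nhds a. f t \<le> f a)"

definition gv_local_extremum ::
  "'a topology \<Rightarrow> 'a chart set \<Rightarrow> 'a plane_field \<Rightarrow> 'a vec_field \<Rightarrow> bool" where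
  "gv_local_extremum X A D T \<longleftrightarrow>
     (\<forall>\<epsilon> \<omega>t Tt. variation A D T \<epsilon> \<omega>t Tt \<longrightarrow>
        local_min_at (\<lambda>t. gv X A (ker_form (\<omega>t t)) (Tt t)) 0) \<or>
     (\<forall>\<epsilon> \<omega>t Tt. variation A D T \<epsilon> \<omega>t Tt \<longrightarrow>
        local_max_at (\<lambda>t. gv X A (ker_form (\<omega>t t)) (Tt t)) 0)"

end

theory Submission
  imports Defs
begin

text \<open>For the Reeb field \<open>\<eta> = \<iota>\<^sub>T d\<omega>\<close> vanishes, so along a variation \<open>\<eta>\<^sub>t\<close> and \<open>d\<eta>\<^sub>t\<close> are both \<open>O(t)\<close>
  and \<open>gv\<close> is \<open>O(t\<^sup>2)\<close>. This gives criticality.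

  For non-extremality keep \<open>\<omega>\<close> and replace \<open>T\<close> by \<open>T + t V\<close> with \<open>V\<close> tangent to \<open>ker \<omega>\<close>. Then
  \<open>\<eta>\<^sub>t = t \<beta>\<close> with \<open>\<beta> = \<iota>\<^sub>V d\<omega>\<close>, so \<open>gv\<close> equals \<open>t\<^sup>2 \<integral> \<beta> \<and> d\<beta>\<close>. A rapidly oscillating \<open>V\<close> supported
  in one chart makes \<open>\<beta> \<and> d\<beta>\<close> of one sign pointwise, and both signs occur. The pointwise sign is
  preserved by orientation-preserving coordinate changes, so neither Stokes' theorem nor the
  independence of the integral from the partition of unity is needed.\<close>


section \<open>Calculus of smooth maps\<close>

text \<open>Oscillation helps because differentiating cos(k h) and sin(k h) yields a term of order k
  in which (cos, sin) meets its own quarter turn: cos^2 + sin^2 = 1 removes the oscillation and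
  leaves k times a fixed 3-form. Derivatives of the cut-off multiply \<beta> itself and drop out of
  \<beta> \<and> d\<beta>. So the size and sign of k decide the sign of the density. The phase must
  vary in the Reeb direction: every \<iota>_V d\<omega> annihilates T, so the leading term survives
  only if h(T) \<noteq> 0. Freezing \<omega> at one point gives such a linear h.

  Two features of the definitions shape the rest. The integral rests on an unspecified choice of a
  partition of unity, so one must be shown to exist; the choice does not see the integrated form,
  and a whole family can be treated with one partition. And \<open>gv\<close> receives only a plane
  field, so \<omega>_t has to be recovered from its kernel before smoothness in t can be used.

  Comparing charts requires d to commute with coordinate changes, which is where symmetry of second
  derivatives enters.\<close>

lemma times_differentiable_on_cong:
  assumes "open S" "\<And>x. x \<in> S \<Longrightarrow> f x = g x"
  shows "times_differentiable_on n S f \<longleftrightarrow> times_differentiable_on n S g"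
  using assms(2)
proof (induction n arbitrary: f g)
  case 0
  then show ?case by (simp cong: continuous_on_cong)
next
  case (Suc n)
  have diff: "f differentiable (at x) \<longleftrightarrow> g differentiable (at x)" if "x \<in> S" for x
    using that Suc.prems assms(1) unfolding differentiable_def
    by (metis has_derivative_transform_within_open)
  \<comment> \<open>\<open>frechet_derivative\<close> carries information only at points of
    differentiability, so that property is transferred before the derivatives are compared.\<close>
  have deriv: "frechet_derivative f (at x) v = frechet_derivative g (at x) v"
    if "x \<in> S" "f differentiable (at x)" for x v
    using frechet_derivative_transform_within_open[OF that(2) assms(1) that(1)] Suc.prems by auto
  have "times_differentiable_on n S (\<lambda>x. frechet_derivative f (at x) v) \<longleftrightarrow>
      times_differentiable_on n S (\<lambda>x. frechet_derivative g (at x) v)"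
    if "\<forall>x\<in>S. f differentiable (at x)" for v
    by (rule Suc.IH) (use deriv that in blast)
  then show ?case using diff by (metis times_differentiable_on.simps(2))
qed

text \<open>Lets the inductions below work with an explicit formula \<open>f'\<close> in place of
  the choice operator behind \<open>frechet_derivative\<close>.\<close>

lemma times_differentiable_on_SucI:
  assumes "open S" "\<And>x. x \<in> S \<Longrightarrow> (f has_derivative f' x) (at x)"
    and "\<And>v. times_differentiable_on n S (\<lambda>x. f' x v)"
  shows "times_differentiable_on (Suc n) S f"
proof -
  have "times_differentiable_on n S (\<lambda>x. frechet_derivative f (at x) v)" for v
    using times_differentiable_on_cong[OF assms(1), of "\<lambda>x. frechet_derivative f (at x) v" "\<lambda>x. f' x v" n]
      assms(3) frechet_derivative_at[OF assms(2)] by metis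
  then show ?thesis using assms(2) by (auto simp: differentiable_def)
qed

lemma times_differentiable_on_SucD:
  "times_differentiable_on (Suc n) S f \<Longrightarrow> times_differentiable_on n S f"
proof (induction n arbitrary: f)
  case 0
  then show ?case
    by (auto intro!: continuous_at_imp_continuous_on differentiable_imp_continuous_within)
next
  case (Suc n)
  then show ?case by (metis times_differentiable_on.simps(2))
qed

lemma times_differentiable_on_subset:
  "times_differentiable_on n S f \<Longrightarrow> T \<subseteq> S \<Longrightarrow> times_differentiable_on n T f"
  by (induction n arbitrary: f) (auto intro: continuous_on_subset)

lemma times_differentiable_on_local:
  assumes "\<And>x. x \<in> S \<Longrightarrow> \<exists>U. open U \<and> x \<in> U \<and> times_differentiable_on n U f"
  shows "times_differentiable_on n S f"
  using assms
proof (induction n arbitrary: f)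
  case 0
  then show ?case
    by (auto intro!: continuous_at_imp_continuous_on)
      (metis continuous_on_eq_continuous_at)
next
  case (Suc n)
  have "f differentiable (at x)" if "x \<in> S" for x using Suc.prems[OF that] by auto
  moreover have "times_differentiable_on n S (\<lambda>x. frechet_derivative f (at x) v)" for v
    by (rule Suc.IH) (use Suc.prems in fastforce)
  ultimately show ?case by simp
qed

lemma times_differentiable_on_const: "times_differentiable_on n S (\<lambda>x. c)"
  by (induction n arbitrary: c) auto

lemma times_differentiable_on_bounded_linear:
  assumes "bounded_linear f"
  shows "times_differentiable_on n S f"
proof (cases n)
  case 0
  then show ?thesis using assms by (simp add: linear_continuous_on)
next
  case (Suc m)
  have "frechet_derivative f (at x) = f" for x
    using assms bounded_linear_imp_has_derivative frechet_derivative_at by metis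
  then show ?thesis using Suc assms
    by (auto simp: times_differentiable_on_const bounded_linear_imp_differentiable)
qed

section \<open>Sums, bilinear products and compositions\<close>

lemma times_differentiable_on_add:
  assumes "open S" "times_differentiable_on n S f" "times_differentiable_on n S g"
  shows "times_differentiable_on n S (\<lambda>x. f x + g x)"
  using assms(2,3)
proof (induction n arbitrary: f g)
  case 0
  then show ?case by (auto intro: continuous_intros)
next
  case (Suc n)
  show ?case
  proof (rule times_differentiable_on_SucI[OF assms(1)])
    show "((\<lambda>x. f x + g x) has_derivative
        (\<lambda>v. frechet_derivative f (at x) v + frechet_derivative g (at x) v)) (at x)"
      if "x \<in> S" for x
      using Suc.prems that
      by (intro has_derivative_add) (auto simp: frechet_derivative_works[symmetric])
    show "times_differentiable_on n S
        (\<lambda>x. frechet_derivative f (at x) v + frechet_derivative g (at x) v)" for v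
      using Suc by simp
  qed
qed

lemma times_differentiable_on_bilinear:
  assumes bl: "bounded_bilinear h"
    and S: "open S" and "times_differentiable_on n S f" "times_differentiable_on n S g"
  shows "times_differentiable_on n S (\<lambda>x. h (f x) (g x))"
  using assms(3,4)
proof (induction n arbitrary: f g)
  case 0
  then show ?case by (auto intro: bounded_bilinear.continuous_on[OF bl])
next
  case (Suc n)
  show ?case
  proof (rule times_differentiable_on_SucI[OF S])
    show "((\<lambda>x. h (f x) (g x)) has_derivative
        (\<lambda>v. h (f x) (frechet_derivative g (at x) v) + h (frechet_derivative f (at x) v) (g x))) (at x)"
      if "x \<in> S" for x
      using Suc.prems that
      by (intro bounded_bilinear.FDERIV[OF bl]) (auto simp: frechet_derivative_works[symmetric])
    show "times_differentiable_on n S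
        (\<lambda>x. h (f x) (frechet_derivative g (at x) v) + h (frechet_derivative f (at x) v) (g x))" for v
      \<comment> \<open>The Leibniz rule pairs a derivative, known at level \<open>n\<close>, with
        an underived factor known at level \<open>Suc n\<close>; the latter is lowered to
        \<open>n\<close> before the induction hypothesis applies.\<close>
      using Suc.prems Suc.prems[THEN times_differentiable_on_SucD]
      by (intro times_differentiable_on_add S Suc.IH) simp_all
  qed
qed

lemma times_differentiable_on_sum:
  assumes "open S" "\<And>i. i \<in> I \<Longrightarrow> times_differentiable_on n S (f i)"
  shows "times_differentiable_on n S (\<lambda>x. \<Sum>i\<in>I. f i x)"
  using assms(2)
  by (induction I rule: infinite_finite_induct)
    (auto simp: times_differentiable_on_const intro: times_differentiable_on_add[OF assms(1)])

lemma linear_eq_sum_Basis: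
  fixes f :: "'a::euclidean_space \<Rightarrow> 'b::real_vector"
  assumes "linear f"
  shows "f v = (\<Sum>b\<in>Basis. (v \<bullet> b) *\<^sub>R f b)"
proof -
  have "f v = f (\<Sum>b\<in>Basis. (v \<bullet> b) *\<^sub>R b)" by (simp add: euclidean_representation)
  then show ?thesis by (simp add: linear_sum[OF assms] linear_scale[OF assms])
qed

text \<open>The definition differentiates along fixed vectors only, while the chain rule
  differentiates \<open>g\<close> along \<open>frechet_derivative f (at x) v\<close>, which moves
  with \<open>x\<close>. Expanding that vector in an orthonormal basis gives a sum of products
  covered by the bilinear case; hence the Euclidean type in the middle.\<close>

lemma times_differentiable_on_compose:
  fixes g :: "'b::euclidean_space \<Rightarrow> 'c::real_normed_vector"
    and f :: "'a::real_normed_vector \<Rightarrow> 'b"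
  assumes S: "open S" and "times_differentiable_on n T g" "times_differentiable_on n S f" "f ` S \<subseteq> T"
  shows "times_differentiable_on n S (\<lambda>x. g (f x))"
  using assms(2,3,4)
proof (induction n arbitrary: g f)
  case 0
  then show ?case by (auto intro: continuous_on_compose2)
next
  case (Suc n)
  show ?case
  proof (rule times_differentiable_on_SucI[OF S])
    show "((\<lambda>x. g (f x)) has_derivative
        (\<lambda>v. \<Sum>b\<in>Basis. (frechet_derivative f (at x) v \<bullet> b) *\<^sub>R frechet_derivative g (at (f x)) b)) (at x)"
      if "x \<in> S" for x
    proof -
      have f: "(f has_derivative frechet_derivative f (at x)) (at x)"
        using Suc.prems that by (simp add: frechet_derivative_works[symmetric])
      have d: "g differentiable (at (f x))"
        using Suc.prems that by auto
      then have g: "(g has_derivative frechet_derivative g (at (f x))) (at (f x))"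
        by (simp add: frechet_derivative_works[symmetric])
      show ?thesis
        using has_derivative_compose[OF f g]
        by (subst (asm) linear_eq_sum_Basis[OF linear_frechet_derivative[OF d]])
    qed
    show "times_differentiable_on n S
        (\<lambda>x. \<Sum>b\<in>Basis. (frechet_derivative f (at x) v \<bullet> b) *\<^sub>R frechet_derivative g (at (f x)) b)" for v
    proof (intro times_differentiable_on_sum S times_differentiable_on_bilinear[OF bounded_bilinear_scaleR]
          times_differentiable_on_bilinear[OF bounded_bilinear_inner] times_differentiable_on_const)
      fix b
      show "times_differentiable_on n S (\<lambda>x. frechet_derivative f (at x) v)"
        using Suc.prems by simp
      show "times_differentiable_on n S (\<lambda>x. frechet_derivative g (at (f x)) b)"
        by (rule Suc.IH) (use Suc.prems Suc.prems(2)[THEN times_differentiable_on_SucD] in simp_all)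
    qed
  qed
qed

lemma smooth_on_cong:
  "open S \<Longrightarrow> (\<And>x. x \<in> S \<Longrightarrow> f x = g x) \<Longrightarrow> smooth_on S f \<longleftrightarrow> smooth_on S g"
  using times_differentiable_on_cong[of S f g] by (simp add: smooth_on_def)

lemma smooth_on_subset: "smooth_on S f \<Longrightarrow> T \<subseteq> S \<Longrightarrow> smooth_on T f"
  unfolding smooth_on_def using times_differentiable_on_subset[of _ S f T] by simp

lemma smooth_on_local:
  assumes "\<And>x. x \<in> S \<Longrightarrow> \<exists>U. open U \<and> x \<in> U \<and> smooth_on U f"
  shows "smooth_on S f"
  unfolding smooth_on_def
proof
  show "times_differentiable_on n S f" for n
    by (rule times_differentiable_on_local) (use assms in \<open>auto simp: smooth_on_def\<close>)
qed

lemma smooth_on_const [simp]: "smooth_on S (\<lambda>x. c)"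
  by (simp add: smooth_on_def times_differentiable_on_const)

lemma smooth_on_bounded_linear: "bounded_linear f \<Longrightarrow> smooth_on S f"
  by (simp add: smooth_on_def times_differentiable_on_bounded_linear)

lemma smooth_on_add:
  "open S \<Longrightarrow> smooth_on S f \<Longrightarrow> smooth_on S g \<Longrightarrow> smooth_on S (\<lambda>x. f x + g x)"
  by (simp add: smooth_on_def times_differentiable_on_add)

lemma smooth_on_sum:
  "open S \<Longrightarrow> (\<And>i. i \<in> I \<Longrightarrow> smooth_on S (f i)) \<Longrightarrow> smooth_on S (\<lambda>x. \<Sum>i\<in>I. f i x)"
  by (simp add: smooth_on_def times_differentiable_on_sum)

lemma smooth_on_bilinear:
  assumes "bounded_bilinear h" "open S" "smooth_on S f" "smooth_on S g"
  shows "smooth_on S (\<lambda>x. h (f x) (g x))"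
  using assms by (simp add: smooth_on_def times_differentiable_on_bilinear)

lemmas smooth_on_mult = smooth_on_bilinear[OF bounded_bilinear_mult]
  and smooth_on_scaleR = smooth_on_bilinear[OF bounded_bilinear_scaleR]
  and smooth_on_inner = smooth_on_bilinear[OF bounded_bilinear_inner]

lemma smooth_on_compose:
  fixes g :: "'b::euclidean_space \<Rightarrow> 'c::real_normed_vector"
    and f :: "'a::real_normed_vector \<Rightarrow> 'b"
  assumes "open S" "smooth_on T g" "smooth_on S f" "f ` S \<subseteq> T"
  shows "smooth_on S (\<lambda>x. g (f x))"
  unfolding smooth_on_def
proof
  show "times_differentiable_on n S (\<lambda>x. g (f x))" for n
    by (rule times_differentiable_on_compose[OF assms(1) _ _ assms(4)])
      (use assms in \<open>simp_all add: smooth_on_def\<close>)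
qed

lemma smooth_on_linear_compose:
  assumes "bounded_linear h" "open S" "smooth_on S f"
  shows "smooth_on S (\<lambda>x. h (f x))"
proof -
  \<comment> \<open>A linear \<open>h\<close> is the bilinear map (r, y) -> r h(y) at r = 1. This
    route leaves the middle space an arbitrary normed space.\<close>
  have "bounded_bilinear (\<lambda>(r::real) y. r *\<^sub>R h y)"
    using bounded_bilinear.comp[OF bounded_bilinear_scaleR bounded_linear_ident assms(1)] .
  from smooth_on_bilinear[OF this assms(2) smooth_on_const assms(3), of 1] show ?thesis by simp
qed

lemma smooth_on_diff:
  fixes f g :: "'a::real_normed_vector \<Rightarrow> 'b::real_normed_vector"
  assumes "open S" "smooth_on S f" "smooth_on S g"
  shows "smooth_on S (\<lambda>x. f x - g x)"
  using smooth_on_add[OF assms(1,2) smooth_on_linear_compose[OF _ assms(1,3), of uminus]]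
  by (simp add: bounded_linear_minus[OF bounded_linear_ident])

lemma smooth_on_imp_differentiable:
  "smooth_on S f \<Longrightarrow> x \<in> S \<Longrightarrow> f differentiable (at x)"
  unfolding smooth_on_def by (drule spec[of _ "Suc 0"]) simp

lemma smooth_on_has_derivative:
  "smooth_on S f \<Longrightarrow> x \<in> S \<Longrightarrow> (f has_derivative frechet_derivative f (at x)) (at x)"
  using smooth_on_imp_differentiable frechet_derivative_works by blast

lemma smooth_on_imp_continuous_on: "smooth_on S f \<Longrightarrow> continuous_on S f"
  unfolding smooth_on_def by (drule spec[of _ 0]) simp

lemma smooth_on_frechet_derivative:
  "smooth_on S f \<Longrightarrow> smooth_on S (\<lambda>x. frechet_derivative f (at x) v)"
  unfolding smooth_on_def
proof
  assume "\<forall>n. times_differentiable_on n S f"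
  then show "times_differentiable_on n S (\<lambda>x. frechet_derivative f (at x) v)" for n
    by (drule_tac spec[of _ "Suc n"]) simp
qed

text \<open>For evaluating a form on a moving vector: smoothness on each fixed vector is enough, by
  linearity and a basis expansion.\<close>

lemma smooth_on_linear_fields:
  fixes a :: "'a::real_normed_vector \<Rightarrow> 'b::euclidean_space \<Rightarrow> 'c::real_normed_vector"
  assumes "open S" "\<And>x. x \<in> S \<Longrightarrow> linear (a x)" "\<And>v. smooth_on S (\<lambda>x. a x v)" "smooth_on S f"
  shows "smooth_on S (\<lambda>x. a x (f x))"
proof -
  have "a x (f x) = (\<Sum>b\<in>Basis. (f x \<bullet> b) *\<^sub>R a x b)" if "x \<in> S" for x
    by (rule linear_eq_sum_Basis[OF assms(2)[OF that]])
  moreover have "smooth_on S (\<lambda>x. \<Sum>b\<in>Basis. (f x \<bullet> b) *\<^sub>R a x b)"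
    using assms by (intro smooth_on_sum smooth_on_scaleR smooth_on_inner smooth_on_const)
  ultimately show ?thesis
    using smooth_on_cong[OF assms(1), of "\<lambda>x. a x (f x)"] by simp
qed

section \<open>Elementary functions and bump functions\<close>

lemma smooth_on_inverse: "smooth_on (- {0::real}) inverse"
  unfolding smooth_on_def
proof
  fix n
  show "times_differentiable_on n (- {0::real}) inverse"
  proof (induction n)
    case 0
    then show ?case by (auto intro!: continuous_on_inverse continuous_intros)
  next
    case (Suc n)
    have op: "open (- {0::real})" by auto
    show ?case
    proof (rule times_differentiable_on_SucI[OF op])
      show "(inverse has_derivative (\<lambda>v. - (inverse x * v * inverse x))) (at x)"
        if "x \<in> - {0::real}" for x
        using that by (intro has_derivative_inverse') auto
      have "times_differentiable_on n (- {0}) (\<lambda>x::real. (- v) * (inverse x * inverse x))" for v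
        by (intro times_differentiable_on_bilinear[OF bounded_bilinear_mult] op
            times_differentiable_on_const Suc)
      then show "times_differentiable_on n (- {0}) (\<lambda>x::real. - (inverse x * v * inverse x))" for v
        by (simp add: ac_simps)
    qed
  qed
qed

lemma smooth_on_divide:
  fixes f g :: "'a::real_normed_vector \<Rightarrow> real"
  assumes "open S" "smooth_on S f" "smooth_on S g" "\<And>x. x \<in> S \<Longrightarrow> g x \<noteq> 0"
  shows "smooth_on S (\<lambda>x. f x / g x)"
  unfolding divide_inverse using assms
  by (intro smooth_on_mult smooth_on_compose[OF _ smooth_on_inverse]) auto

lemma smooth_on_sin_cos: "smooth_on UNIV (sin :: real \<Rightarrow> real)" "smooth_on UNIV (cos :: real \<Rightarrow> real)"
proof -
  \<comment> \<open>Each function is the derivative of the other up to sign, so the induction runs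
    on both at once.\<close>
  have "times_differentiable_on n UNIV (sin :: real \<Rightarrow> real) \<and>
      times_differentiable_on n UNIV (cos :: real \<Rightarrow> real)" for n
  proof (induction n)
    case 0
    then show ?case by (auto intro: continuous_intros)
  next
    case (Suc n)
    have "times_differentiable_on (Suc n) UNIV (sin :: real \<Rightarrow> real)"
    proof (rule times_differentiable_on_SucI)
      show "((sin :: real \<Rightarrow> real) has_derivative (\<lambda>v. v * cos x)) (at x)" for x
        by (auto intro!: derivative_eq_intros simp: mult.commute)
      show "times_differentiable_on n UNIV (\<lambda>x. v * cos x)" for v :: real
        using Suc by (intro times_differentiable_on_bilinear[OF bounded_bilinear_mult]
            times_differentiable_on_const) auto
    qed auto
    moreover have "times_differentiable_on (Suc n) UNIV (cos :: real \<Rightarrow> real)"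
    proof (rule times_differentiable_on_SucI)
      show "((cos :: real \<Rightarrow> real) has_derivative (\<lambda>v. (- v) * sin x)) (at x)" for x
        by (auto intro!: derivative_eq_intros simp: mult.commute)
      show "times_differentiable_on n UNIV (\<lambda>x. (- v) * sin x)" for v :: real
        using Suc by (intro times_differentiable_on_bilinear[OF bounded_bilinear_mult]
            times_differentiable_on_const) auto
    qed auto
    ultimately show ?case by blast
  qed
  then show "smooth_on UNIV (sin :: real \<Rightarrow> real)" "smooth_on UNIV (cos :: real \<Rightarrow> real)"
    by (auto simp: smooth_on_def)
qed

text \<open>The powers of 1/x make the family closed under differentiation up to linear
  combinations, as an induction on the order requires; \<open>m = 0\<close> is the usual flat
  function exp(-1/x).\<close>

definition flat_exp :: "nat \<Rightarrow> real \<Rightarrow> real" where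
  "flat_exp m x = (if x > 0 then inverse x ^ m * exp (- inverse x) else 0)"

lemma flat_exp_tendsto_0: "(flat_exp m \<longlongrightarrow> 0) (at 0)"
proof -
  have "((\<lambda>y::real. y ^ m / exp y) \<longlongrightarrow> 0) at_top"
    by (rule tendsto_power_div_exp_0)
  then have "((\<lambda>x::real. inverse x ^ m / exp (inverse x)) \<longlongrightarrow> 0) (at_right 0)"
    by (rule filterlim_compose[OF _ filterlim_inverse_at_top_right])
  then have r: "(flat_exp m \<longlongrightarrow> 0) (at_right 0)"
    by (rule Lim_transform_eventually)
      (auto simp: eventually_at_filter flat_exp_def exp_minus divide_inverse)
  have "(flat_exp m \<longlongrightarrow> 0) (at_left 0)"
    by (rule Lim_transform_eventually[OF tendsto_const])
      (auto simp: eventually_at_filter flat_exp_def)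
  then show ?thesis using r filterlim_split_at by blast
qed

lemma flat_exp_has_derivative:
  "(flat_exp m has_real_derivative (flat_exp (m + 2) x - m * flat_exp (m + 1) x)) (at x)"
proof -
  consider "x > 0" | "x < 0" | "x = 0" by linarith
  then show ?thesis
  proof cases
    case 1
    have "((\<lambda>x. inverse x ^ m * exp (- inverse x)) has_real_derivative
        (inverse x ^ (m + 2) * exp (- inverse x) - m * (inverse x ^ (m + 1) * exp (- inverse x)))) (at x)"
    proof (cases m)
      case (Suc k)
      show ?thesis
        using 1 unfolding Suc
        by (cases k) (auto intro!: derivative_eq_intros simp: algebra_simps power2_eq_square,
            metis One_nat_def power_eq_if)
    qed (use 1 in \<open>auto intro!: derivative_eq_intros simp: power2_eq_square\<close>)
    moreover have "inverse y ^ m * exp (- inverse y) = flat_exp m y" if "y \<in> {0<..}" for y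
      using that by (simp add: flat_exp_def)
    ultimately show ?thesis
      using 1 has_field_derivative_transform_within_open[of _ _ x "{0<..}" "flat_exp m"]
      by (simp add: flat_exp_def)
  next
    case 2
    have "((\<lambda>x. 0) has_real_derivative 0) (at x)" by simp
    then show ?thesis
      using 2 has_field_derivative_transform_within_open[of "\<lambda>x. 0" 0 x "{..<0}" "flat_exp m"]
      by (simp add: flat_exp_def)
  next
    case 3
    \<comment> \<open>The difference quotient of \<open>flat_exp m\<close> at 0 is
      \<open>flat_exp (m + 1)\<close> itself.\<close>
    have "((\<lambda>y. (flat_exp m y - flat_exp m 0) / (y - 0)) \<longlongrightarrow> 0) (at 0)"
      by (rule Lim_transform_eventually[OF flat_exp_tendsto_0[of "m + 1"]])
        (auto simp: flat_exp_def divide_inverse)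
    then show ?thesis using 3 by (simp add: has_field_derivative_iff flat_exp_def)
  qed
qed

lemma smooth_on_flat_exp: "smooth_on UNIV (flat_exp m)"
  unfolding smooth_on_def
proof
  fix n
  show "times_differentiable_on n UNIV (flat_exp m)"
  proof (induction n arbitrary: m)
    case 0
    then show ?case
      using DERIV_isCont[OF flat_exp_has_derivative]
      by (auto intro!: continuous_at_imp_continuous_on)
  next
    case (Suc n)
    show ?case
    proof (rule times_differentiable_on_SucI)
      show "(flat_exp m has_derivative
          (\<lambda>v. v * flat_exp (m + 2) x + (- v * m) * flat_exp (m + 1) x)) (at x)" for x
        by (rule has_derivative_eq_rhs[OF flat_exp_has_derivative[of m x, unfolded has_field_derivative_def]])
          (auto simp: algebra_simps)
      show "times_differentiable_on n UNIV
          (\<lambda>x. v * flat_exp (m + 2) x + (- v * m) * flat_exp (m + 1) x)" for v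
        by (intro times_differentiable_on_add times_differentiable_on_const Suc open_UNIV
            times_differentiable_on_bilinear[OF bounded_bilinear_mult])
    qed auto
  qed
qed

text \<open>The squared distance, unlike the distance, is smooth at the centre
  \<open>p\<close>.\<close>

definition bump :: "'a::real_inner \<Rightarrow> real \<Rightarrow> 'a \<Rightarrow> real" where
  "bump p r x = flat_exp 0 (r\<^sup>2 - (x - p) \<bullet> (x - p))"

lemma smooth_on_bump: "smooth_on UNIV (bump (p::'a::euclidean_space) r)"
proof -
  have "smooth_on UNIV (\<lambda>x. r\<^sup>2 - (x - p) \<bullet> (x - p))"
    by (intro smooth_on_diff smooth_on_inner smooth_on_const open_UNIV
        smooth_on_bounded_linear bounded_linear_ident)
  then show ?thesis
    unfolding bump_def by (intro smooth_on_compose[OF _ smooth_on_flat_exp]) auto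
qed

lemma bump_nonneg: "0 \<le> bump p r x"
  by (simp add: bump_def flat_exp_def)

lemma bump_eq_0_iff:
  assumes "r > 0"
  shows "bump p r x = 0 \<longleftrightarrow> x \<notin> ball p r"
proof -
  have "(x - p) \<bullet> (x - p) = (dist p x)\<^sup>2"
    by (simp add: dist_norm power2_norm_eq_inner inner_diff_left inner_diff_right inner_commute)
  moreover have "(dist p x)\<^sup>2 < r\<^sup>2 \<longleftrightarrow> dist p x < r"
    using assms by (auto intro: power_strict_mono power_less_imp_less_base)
  ultimately show ?thesis by (simp add: bump_def flat_exp_def)
qed


section \<open>Symmetry of second derivatives\<close>

lemma frechet_derivative_eqI:
  assumes "(f has_derivative f') (at x)"
  shows "frechet_derivative f (at x) v = f' v"
  using frechet_derivative_at[OF assms] by simp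

lemma has_real_derivative_along_line:
  fixes f :: "'a::real_normed_vector \<Rightarrow> real"
  assumes "f differentiable (at (p + a *\<^sub>R u))"
  shows "((\<lambda>a. f (p + a *\<^sub>R u)) has_real_derivative frechet_derivative f (at (p + a *\<^sub>R u)) u) (at a)"
proof -
  have f: "(f has_derivative frechet_derivative f (at (p + a *\<^sub>R u))) (at (p + a *\<^sub>R u))"
    using assms frechet_derivative_works by blast
  have "((\<lambda>a. p + a *\<^sub>R u) has_derivative (\<lambda>b. b *\<^sub>R u)) (at a)"
    by (auto intro!: derivative_eq_intros)
  from has_derivative_compose[OF this f] show ?thesis
    by (simp add: has_field_derivative_def linear_scale[OF linear_frechet_derivative[OF assms]]
        mult_commute_abs)
qed

text \<open>The mean value theorem, applied along \<open>u\<close> and then along \<open>v\<close>,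
  turns the second difference into s^2 times the mixed derivative at an intermediate point, and
  continuity moves that point to \<open>x\<close>. The second difference is symmetric in
  \<open>u\<close> and \<open>v\<close>, which is how the two orders of differentiation get
  compared.\<close>

lemma second_difference_quotient:
  fixes f :: "'a::real_normed_vector \<Rightarrow> real"
  assumes S: "open S" "x \<in> S" and f: "smooth_on S f" and "e > 0"
  shows "\<exists>\<delta>>0. \<forall>s. 0 < s \<and> s < \<delta> \<longrightarrow>
    \<bar>(f (x + s *\<^sub>R u + s *\<^sub>R v) - f (x + s *\<^sub>R u) - f (x + s *\<^sub>R v) + f x) / s\<^sup>2 -
      frechet_derivative (\<lambda>y. frechet_derivative f (at y) u) (at x) v\<bar> < e"
proof -
  define fu where "fu y = frechet_derivative f (at y) u" for y
  define fuv where "fuv y = frechet_derivative fu (at y) v" for y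
  have fu: "smooth_on S fu" unfolding fu_def by (rule smooth_on_frechet_derivative[OF f])
  have "smooth_on S fuv" unfolding fuv_def by (rule smooth_on_frechet_derivative[OF fu])
  then have "isCont fuv x"
    using smooth_on_imp_continuous_on S continuous_on_eq_continuous_at by blast
  then obtain r1 where r1: "r1 > 0" "\<And>y. dist y x < r1 \<Longrightarrow> \<bar>fuv y - fuv x\<bar> < e"
    using \<open>e > 0\<close> unfolding continuous_at_eps_delta dist_real_def by blast
  obtain r2 where r2: "r2 > 0" "ball x r2 \<subseteq> S" using S open_contains_ball by blast
  define r where "r = min r1 r2"
  \<comment> \<open>Keeps the parallelogram with sides \<open>s u\<close> and \<open>s v\<close>
    within distance \<open>r\<close> of \<open>x\<close>; the summand 1 covers the case of two zero
    vectors.\<close>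
  define \<delta> where "\<delta> = r / (norm u + norm v + 1)"
  have pos: "norm u + norm v + 1 > 0" by (simp add: add_nonneg_pos)
  have "\<delta> > 0" using r1 r2 pos by (simp add: \<delta>_def r_def)
  have near: "dist (x + a *\<^sub>R u + b *\<^sub>R v) x < r"
    if "0 \<le> a" "0 \<le> b" "a \<le> s" "b \<le> s" "s < \<delta>" for a b s
  proof -
    have "norm (a *\<^sub>R u + b *\<^sub>R v) \<le> a * norm u + b * norm v"
      using that norm_triangle_ineq[of "a *\<^sub>R u" "b *\<^sub>R v"] by simp
    also have "\<dots> \<le> s * norm u + s * norm v"
      using that by (intro add_mono mult_right_mono) auto
    also have "\<dots> \<le> s * (norm u + norm v + 1)" using that by (simp add: algebra_simps)
    also have "\<dots> < \<delta> * (norm u + norm v + 1)" using that pos by simp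
    also have "\<dots> = r" using pos by (simp add: \<delta>_def)
    finally show ?thesis by (simp add: dist_norm add.assoc)
  qed
  have inS: "x + a *\<^sub>R u + b *\<^sub>R v \<in> S"
    if "0 \<le> a" "0 \<le> b" "a \<le> s" "b \<le> s" "s < \<delta>" for a b s
    using near[OF that] r2 by (auto simp: r_def dist_commute)
  have "\<bar>(f (x + s *\<^sub>R u + s *\<^sub>R v) - f (x + s *\<^sub>R u) - f (x + s *\<^sub>R v) + f x) / s\<^sup>2 - fuv x\<bar> < e"
    if s: "0 < s" "s < \<delta>" for s
  proof -
    have diff: "f differentiable (at (x + a *\<^sub>R u + b *\<^sub>R v))" "fu differentiable (at (x + a *\<^sub>R u + b *\<^sub>R v))"
      if "0 \<le> a" "0 \<le> b" "a \<le> s" "b \<le> s" for a b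
      using smooth_on_imp_differentiable f fu inS that s by blast+
    \<comment> \<open>The increment of this function over [0, s] is the second difference.\<close>
    have d1: "((\<lambda>a. f (x + s *\<^sub>R v + a *\<^sub>R u) - f (x + a *\<^sub>R u)) has_real_derivative
        (fu (x + s *\<^sub>R v + a *\<^sub>R u) - fu (x + a *\<^sub>R u))) (at a)" if "0 \<le> a" "a \<le> s" for a
      unfolding fu_def
      using diff(1)[of a s] diff(1)[of a 0] that s
      by (intro DERIV_diff has_real_derivative_along_line) (auto simp: ac_simps)
    obtain a where a: "0 < a" "a < s"
      "f (x + s *\<^sub>R v + s *\<^sub>R u) - f (x + s *\<^sub>R u) - (f (x + s *\<^sub>R v) - f x) =
        s * (fu (x + s *\<^sub>R v + a *\<^sub>R u) - fu (x + a *\<^sub>R u))"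
      using MVT2[OF s(1) d1] by auto
    have d2: "((\<lambda>b. fu (x + a *\<^sub>R u + b *\<^sub>R v)) has_real_derivative
        fuv (x + a *\<^sub>R u + b *\<^sub>R v)) (at b)" if "0 \<le> b" "b \<le> s" for b
      unfolding fuv_def
      using diff(2)[of a b] that a by (intro has_real_derivative_along_line) auto
    obtain b where b: "0 < b" "b < s"
      "fu (x + a *\<^sub>R u + s *\<^sub>R v) - fu (x + a *\<^sub>R u) = s * fuv (x + a *\<^sub>R u + b *\<^sub>R v)"
      using MVT2[OF s(1) d2] by auto
    have "f (x + s *\<^sub>R u + s *\<^sub>R v) - f (x + s *\<^sub>R u) - f (x + s *\<^sub>R v) + f x =
        s * (s * fuv (x + a *\<^sub>R u + b *\<^sub>R v))"
      using a(3) b(3) by (simp add: ac_simps)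
    then have "(f (x + s *\<^sub>R u + s *\<^sub>R v) - f (x + s *\<^sub>R u) - f (x + s *\<^sub>R v) + f x) / s\<^sup>2 =
        fuv (x + a *\<^sub>R u + b *\<^sub>R v)"
      using s by (simp add: power2_eq_square)
    then show ?thesis using r1(2) near[of a b s] a b s by (simp add: r_def)
  qed
  then show ?thesis using \<open>\<delta> > 0\<close> unfolding fuv_def fu_def by blast
qed

lemma second_derivative_commute_real:
  fixes f :: "'a::real_normed_vector \<Rightarrow> real"
  assumes "open S" "x \<in> S" "smooth_on S f"
  shows "frechet_derivative (\<lambda>y. frechet_derivative f (at y) u) (at x) v =
    frechet_derivative (\<lambda>y. frechet_derivative f (at y) v) (at x) u" (is "?L = ?R")
proof (rule ccontr)
  assume "?L \<noteq> ?R"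
  \<comment> \<open>Half the gap: the intervals of radius \<open>e\<close> about the two mixed
    derivatives are disjoint, yet both would contain the same quotient.\<close>
  define e where "e = \<bar>?L - ?R\<bar> / 2"
  have "e > 0" using \<open>?L \<noteq> ?R\<close> by (simp add: e_def)
  let ?q = "\<lambda>s. (f (x + s *\<^sub>R u + s *\<^sub>R v) - f (x + s *\<^sub>R u) - f (x + s *\<^sub>R v) + f x) / s\<^sup>2"
  obtain d1 where d1: "d1 > 0" "\<And>s. 0 < s \<and> s < d1 \<Longrightarrow> \<bar>?q s - ?L\<bar> < e"
    using second_difference_quotient[OF assms \<open>e > 0\<close>, of u v] by blast
  obtain d2 where d2: "d2 > 0" "\<And>s. 0 < s \<and> s < d2 \<Longrightarrow>
      \<bar>(f (x + s *\<^sub>R v + s *\<^sub>R u) - f (x + s *\<^sub>R v) - f (x + s *\<^sub>R u) + f x) / s\<^sup>2 - ?R\<bar> < e"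
    using second_difference_quotient[OF assms \<open>e > 0\<close>, of v u] by blast
  define s where "s = min d1 d2 / 2"
  have s: "0 < s" "s < d1" "s < d2" using d1(1) d2(1) by (auto simp: s_def)
  have "(f (x + s *\<^sub>R v + s *\<^sub>R u) - f (x + s *\<^sub>R v) - f (x + s *\<^sub>R u) + f x) / s\<^sup>2 = ?q s"
    by (simp add: ac_simps)
  then have "\<bar>?q s - ?L\<bar> < e" "\<bar>?q s - ?R\<bar> < e" using d1(2) d2(2) s by metis+
  then show False unfolding e_def by argo
qed

lemma frechet_derivative_inner_left:
  assumes "f differentiable (at x)"
  shows "frechet_derivative (\<lambda>y. f y \<bullet> b) (at x) v = frechet_derivative f (at x) v \<bullet> b"
proof -
  have "(f has_derivative frechet_derivative f (at x)) (at x)"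
    using assms frechet_derivative_works by blast
  then show ?thesis by (intro frechet_derivative_eqI has_derivative_inner_left)
qed

lemma second_derivative_commute:
  fixes f :: "'a::real_normed_vector \<Rightarrow> 'b::euclidean_space"
  assumes S: "open S" "x \<in> S" and f: "smooth_on S f"
  shows "frechet_derivative (\<lambda>y. frechet_derivative f (at y) u) (at x) v =
    frechet_derivative (\<lambda>y. frechet_derivative f (at y) v) (at x) u"
proof (rule euclidean_eqI)
  fix b :: 'b
  have comp: "frechet_derivative (\<lambda>y. frechet_derivative f (at y) u) (at x) v \<bullet> b =
    frechet_derivative (\<lambda>y. frechet_derivative (\<lambda>y. f y \<bullet> b) (at y) u) (at x) v" for u v
  proof -
    have "frechet_derivative (\<lambda>y. frechet_derivative f (at y) u) (at x) v \<bullet> b =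
        frechet_derivative (\<lambda>y. frechet_derivative f (at y) u \<bullet> b) (at x) v"
      by (rule frechet_derivative_inner_left[symmetric])
        (rule smooth_on_imp_differentiable[OF smooth_on_frechet_derivative[OF f] S(2)])
    also have "\<dots> = frechet_derivative (\<lambda>y. frechet_derivative (\<lambda>y. f y \<bullet> b) (at y) u) (at x) v"
    proof -
      have "(\<lambda>y. frechet_derivative f (at y) u \<bullet> b) differentiable (at x)"
        by (rule smooth_on_imp_differentiable[OF smooth_on_inner S(2)])
          (auto intro: S smooth_on_frechet_derivative f)
      then have "frechet_derivative (\<lambda>y. frechet_derivative f (at y) u \<bullet> b) (at x) =
          frechet_derivative (\<lambda>y. frechet_derivative (\<lambda>y. f y \<bullet> b) (at y) u) (at x)"
        by (rule frechet_derivative_transform_within_open[OF _ S])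
          (rule frechet_derivative_inner_left[symmetric], rule smooth_on_imp_differentiable[OF f])
      then show ?thesis by (rule fun_cong)
    qed
    finally show ?thesis .
  qed
  have "smooth_on S (\<lambda>y. f y \<bullet> b)" by (intro smooth_on_inner S f smooth_on_const)
  from second_derivative_commute_real[OF S this, of u v]
  show "frechet_derivative (\<lambda>y. frechet_derivative f (at y) u) (at x) v \<bullet> b =
    frechet_derivative (\<lambda>y. frechet_derivative f (at y) v) (at x) u \<bullet> b"
    by (simp only: comp)
qed


section \<open>Charts and transition maps\<close>

locale closed_manifold =
  fixes X :: "'a topology" and A :: "'a chart set"
  assumes manifold: "closed_oriented_3manifold X A"
begin

lemma Hausdorff: "Hausdorff_space X" and compact: "compact_space X"
  using manifold by (auto simp: closed_oriented_3manifold_def)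

lemma chart_cover: "q \<in> topspace X \<Longrightarrow> \<exists>c\<in>A. q \<in> chart_dom c"
  using manifold by (auto simp: closed_oriented_3manifold_def oriented_smooth_atlas_def)

context
  fixes c assumes c: "c \<in> A"
begin

lemma chart: "is_chart X c"
  using manifold c by (auto simp: closed_oriented_3manifold_def oriented_smooth_atlas_def)

lemma openin_chart_dom: "openin X (chart_dom c)"
  and open_chart_range: "open (chart_range c)"
  and chart_homeo: "homeomorphic_map (subtopology X (chart_dom c)) (top_of_set (chart_range c)) (chart_map c)"
  using chart by (auto simp: is_chart_def)

lemma chart_dom_subset: "chart_dom c \<subseteq> topspace X"
  by (rule openin_subset[OF openin_chart_dom])

lemma chart_map_inj: "inj_on (chart_map c) (chart_dom c)"
  using homeomorphic_imp_injective_map[OF chart_homeo] chart_dom_subset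
  by (simp add: Int_absorb1)

lemma chart_map_in_range: "q \<in> chart_dom c \<Longrightarrow> chart_map c q \<in> chart_range c"
  by (simp add: chart_range_def)

lemma chart_inv_map [simp]: "q \<in> chart_dom c \<Longrightarrow> chart_inv c (chart_map c q) = q"
  using chart_map_inj by (simp add: chart_inv_def)

lemma chart_inv_in_dom: "y \<in> chart_range c \<Longrightarrow> chart_inv c y \<in> chart_dom c"
  by (simp add: chart_inv_def chart_range_def inv_into_into)

lemma chart_map_inv [simp]: "y \<in> chart_range c \<Longrightarrow> chart_map c (chart_inv c y) = y"
  by (simp add: chart_inv_def chart_range_def f_inv_into_f)

lemma overlap_iff: "y \<in> overlap c d \<longleftrightarrow> y \<in> chart_range c \<and> chart_inv c y \<in> chart_dom d"
  by (auto simp: overlap_def chart_range_def image_iff)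

lemma open_chart_image:
  assumes "openin X U"
  shows "open (chart_map c ` (chart_dom c \<inter> U))"
proof -
  have "openin (subtopology X (chart_dom c)) (chart_dom c \<inter> U)"
    using assms by (simp add: openin_subtopology_Int2)
  then have "openin (top_of_set (chart_range c)) (chart_map c ` (chart_dom c \<inter> U))"
    using homeomorphic_map_openness_eq[OF chart_homeo] by blast
  then show ?thesis using open_chart_range openin_open_trans by blast
qed

lemma open_overlap: "d \<in> A \<Longrightarrow> open (overlap c d)"
  using open_chart_image chart closed_manifold_axioms
  by (simp add: overlap_def closed_manifold.openin_chart_dom)

lemma openin_chart_vimage:
  assumes "open V"
  shows "openin X {q \<in> chart_dom c. chart_map c q \<in> V}"
proof -
  have "continuous_map (subtopology X (chart_dom c)) (top_of_set (chart_range c)) (chart_map c)"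
    using chart_homeo homeomorphic_imp_continuous_map by blast
  then have "openin (subtopology X (chart_dom c))
      {q \<in> topspace (subtopology X (chart_dom c)). chart_map c q \<in> chart_range c \<inter> V}"
    using assms openin_open_Int[of V "chart_range c"] by (simp only: continuous_map_def)
  moreover have "{q \<in> topspace (subtopology X (chart_dom c)). chart_map c q \<in> chart_range c \<inter> V} =
      {q \<in> chart_dom c. chart_map c q \<in> V}"
    using chart_dom_subset chart_map_in_range by auto
  ultimately show ?thesis using openin_chart_dom openin_trans_full by metis
qed

lemma compact_chart_image:
  assumes "closedin X K" "K \<subseteq> chart_dom c"
  shows "compact (chart_map c ` K)"
proof -
  have "compactin X K" using compact assms(1) by (simp add: closedin_compact_space)
  then have "compactin (subtopology X (chart_dom c)) K"
    using assms(2) by (simp add: compactin_subtopology)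
  then have "compactin (top_of_set (chart_range c)) (chart_map c ` K)"
    using image_compactin chart_homeo homeomorphic_imp_continuous_map by blast
  then show ?thesis by (simp add: compactin_subtopology)
qed

text \<open>The set is compact in \<open>X\<close>, and Hausdorffness makes it closed. Closedness in
  all of \<open>X\<close>, not merely in the chart, is what later permits extension by zero.\<close>

lemma closedin_chart_inv_image:
  assumes "compact K" "K \<subseteq> chart_range c"
  shows "closedin X (chart_inv c ` K)"
proof -
  obtain g where g: "homeomorphic_maps (subtopology X (chart_dom c)) (top_of_set (chart_range c)) (chart_map c) g"
    using chart_homeo homeomorphic_map_maps by blast
  have "g y = chart_inv c y" if "y \<in> K" for y
  proof -
    have "y \<in> chart_range c" using that assms by blast
    then have "g y \<in> chart_dom c" "chart_map c (g y) = y"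
      using g chart_dom_subset
      by (auto simp: homeomorphic_maps_def continuous_map_def Pi_iff)
    then show ?thesis using chart_inv_map by metis
  qed
  then have "chart_inv c ` K = g ` K" by auto
  moreover have "compactin (top_of_set (chart_range c)) K"
    using assms by (simp add: compactin_subtopology)
  then have "compactin (subtopology X (chart_dom c)) (g ` K)"
    using g image_compactin unfolding homeomorphic_maps_def by blast
  ultimately show ?thesis
    using compactin_imp_closedin[OF Hausdorff] by (simp add: compactin_subtopology)
qed

end

section \<open>Transition maps and extension by zero\<close>

lemma transition_smooth: "c \<in> A \<Longrightarrow> d \<in> A \<Longrightarrow> smooth_on (overlap c d) (transition c d)"
  and transition_det_pos: "c \<in> A \<Longrightarrow> d \<in> A \<Longrightarrow> x \<in> overlap c d \<Longrightarrow> det (matrix (transition_deriv c d x)) > 0"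
  using manifold by (auto simp: closed_oriented_3manifold_def oriented_smooth_atlas_def)

lemma transition_has_derivative:
  "c \<in> A \<Longrightarrow> d \<in> A \<Longrightarrow> x \<in> overlap c d \<Longrightarrow>
    (transition c d has_derivative transition_deriv c d x) (at x)"
  by (rule smooth_on_has_derivative[OF transition_smooth])

lemma linear_transition_deriv:
  "c \<in> A \<Longrightarrow> d \<in> A \<Longrightarrow> x \<in> overlap c d \<Longrightarrow> linear (transition_deriv c d x)"
  using transition_has_derivative has_derivative_linear by blast

lemma transition_in_overlap:
  assumes "c \<in> A" "d \<in> A" "x \<in> overlap c d"
  shows "transition c d x \<in> overlap d c"
  using assms by (simp add: overlap_iff transition_def chart_map_in_range chart_inv_in_dom)

lemma chart_inv_transition:
  assumes "c \<in> A" "d \<in> A" "x \<in> overlap c d"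
  shows "chart_inv d (transition c d x) = chart_inv c x"
  using assms by (simp add: overlap_iff transition_def)

lemma transition_transition:
  assumes "c \<in> A" "d \<in> A" "x \<in> overlap c d"
  shows "transition d e (transition c d x) = transition c e x"
  using chart_inv_transition[OF assms] by (simp add: transition_def)

lemma transition_self: "c \<in> A \<Longrightarrow> x \<in> chart_range c \<Longrightarrow> transition c c x = x"
  by (simp add: transition_def)

lemma overlap_self: "c \<in> A \<Longrightarrow> overlap c c = chart_range c"
  by (auto simp: overlap_iff chart_inv_in_dom)

lemma transition_deriv_self:
  assumes "c \<in> A" "x \<in> chart_range c"
  shows "transition_deriv c c x v = v"
proof -
  have "((\<lambda>x. x) has_derivative (\<lambda>v. v)) (at x)" by (rule has_derivative_ident)
  then have "(transition c c has_derivative (\<lambda>v. v)) (at x)"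
    by (rule has_derivative_transform_within_open[OF _ open_chart_range[OF assms(1)] assms(2)])
      (simp add: transition_self[OF assms(1)])
  then show ?thesis by (rule frechet_derivative_eqI)
qed

text \<open>The chain rule applied to the cocycle identity of transition maps; it gives the
  transformation law of a field carried over from one chart to the others.\<close>

lemma transition_deriv_compose:
  assumes "c \<in> A" "d \<in> A" "e \<in> A" "x \<in> overlap c d" "x \<in> overlap c e"
  shows "transition_deriv d e (transition c d x) (transition_deriv c d x v) = transition_deriv c e x v"
proof -
  have "transition c d x \<in> overlap d e"
    using assms transition_in_overlap[of c d x] chart_inv_transition[of c d x] by (simp add: overlap_iff)
  from has_derivative_compose[OF transition_has_derivative transition_has_derivative, OF assms(1,2,4,2,3) this]
  have "((\<lambda>y. transition d e (transition c d y)) has_derivative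
      (\<lambda>v. transition_deriv d e (transition c d x) (transition_deriv c d x v))) (at x)" .
  then have "(transition c e has_derivative
      (\<lambda>v. transition_deriv d e (transition c d x) (transition_deriv c d x v))) (at x)"
    by (rule has_derivative_transform_within_open[OF _ open_overlap[OF assms(1,2)] assms(4)])
      (simp add: transition_transition assms)
  then show ?thesis by (rule frechet_derivative_eqI[symmetric])
qed

text \<open>Two open sets cover the range of \<open>d\<close>: the overlap with \<open>c\<close>,
  where \<open>f\<close> is smooth by assumption, and the part missing \<open>K\<close>, where it
  vanishes. The second is open because \<open>K\<close> is closed in \<open>X\<close>.\<close>

lemma smooth_on_extend_zero:
  assumes c: "c \<in> A" and d: "d \<in> A" and K: "closedin X K" "K \<subseteq> chart_dom c"
    and f: "smooth_on (overlap d c) f" "\<And>y. y \<in> chart_range d \<Longrightarrow> chart_inv d y \<notin> K \<Longrightarrow> f y = 0"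
  shows "smooth_on (chart_range d) f"
proof (rule smooth_on_local)
  fix y assume y: "y \<in> chart_range d"
  show "\<exists>U. open U \<and> y \<in> U \<and> smooth_on U f"
  proof (cases "chart_inv d y \<in> K")
    case True
    then have "y \<in> overlap d c" using K y by (auto simp: overlap_iff d)
    then show ?thesis using f(1) open_overlap[OF d c] by blast
  next
    case False
    let ?U = "chart_map d ` (chart_dom d \<inter> (topspace X - K))"
    have U: "open ?U" by (rule open_chart_image[OF d]) (use K in blast)
    have "y \<in> ?U"
      using False y d chart_inv_in_dom[OF d y] chart_dom_subset[OF d]
      by (intro image_eqI[of _ _ "chart_inv d y"]) auto
    moreover have "smooth_on ?U f"
    proof -
      have "f z = 0" if "z \<in> ?U" for z
        using that f(2) d by (auto simp: chart_map_in_range)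
      then show ?thesis using smooth_on_cong[OF U, of f "\<lambda>_. 0"] by simp
    qed
    ultimately show ?thesis using U by blast
  qed
qed

lemma smooth_function_imp_continuous_on:
  "smooth_function A f \<Longrightarrow> c \<in> A \<Longrightarrow> continuous_on (chart_range c) (\<lambda>x. f (chart_inv c x))"
  by (simp add: smooth_function_def smooth_on_imp_continuous_on)


section \<open>Smooth partitions of unity\<close>

text \<open>Two sets are recorded for two ends: the open \<open>U\<close>, where the function is
  positive, for a finite subcover, and the closed \<open>K\<close>, a closed ball in the chart, to
  trap the closure of the support.\<close>

lemma bump_function_exists:
  assumes c: "c \<in> A" and q: "q \<in> chart_dom c"
  obtains \<Phi> K U where "smooth_function A \<Phi>" "\<And>p. 0 \<le> \<Phi> p" "closedin X K" "K \<subseteq> chart_dom c"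
    "\<And>p. p \<in> topspace X - K \<Longrightarrow> \<Phi> p = 0" "openin X U" "q \<in> U" "\<And>p. p \<in> U \<Longrightarrow> \<Phi> p > 0"
proof -
  let ?x = "chart_map c q"
  obtain r where r: "r > 0" "cball ?x r \<subseteq> chart_range c"
    using open_contains_cball open_chart_range[OF c] chart_map_in_range[OF c q] by blast
  define \<Phi> where "\<Phi> p = (if p \<in> chart_dom c then bump ?x r (chart_map c p) else 0)" for p
  define K where "K = chart_inv c ` cball ?x r"
  define U where "U = {p \<in> chart_dom c. chart_map c p \<in> ball ?x r}"
  have K: "closedin X K" "K \<subseteq> chart_dom c"
    using r closedin_chart_inv_image[OF c] chart_inv_in_dom[OF c] by (auto simp: K_def)
  have zero: "\<Phi> p = 0" if "p \<notin> K" for p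
  proof (cases "p \<in> chart_dom c")
    case True
    then have "chart_map c p \<notin> cball ?x r" using that c by (metis K_def chart_inv_map imageI)
    then show ?thesis using r by (simp add: \<Phi>_def bump_eq_0_iff)
  qed (simp add: \<Phi>_def)
  have "smooth_function A \<Phi>"
    unfolding smooth_function_def
  proof
    fix d assume d: "d \<in> A"
    show "smooth_on (chart_range d) (\<lambda>y. \<Phi> (chart_inv d y))"
    proof (rule smooth_on_extend_zero[OF c d K])
      have "smooth_on (overlap d c) (\<lambda>y. bump ?x r (transition d c y))"
        by (rule smooth_on_compose[OF _ smooth_on_bump transition_smooth])
          (auto simp: c d open_overlap)
      then show "smooth_on (overlap d c) (\<lambda>y. \<Phi> (chart_inv d y))"
        using smooth_on_cong[OF open_overlap[OF d c], of "\<lambda>y. \<Phi> (chart_inv d y)" "\<lambda>y. bump ?x r (transition d c y)"]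
        by (simp add: \<Phi>_def overlap_iff d transition_def)
    qed (rule zero)
  qed
  moreover have "openin X U" unfolding U_def by (rule openin_chart_vimage[OF c]) auto
  moreover have "\<Phi> p > 0" if "p \<in> U" for p
    using that r bump_nonneg[of ?x r "chart_map c p"] bump_eq_0_iff[of r ?x "chart_map c p"]
    by (auto simp: U_def \<Phi>_def)
  moreover have "0 \<le> \<Phi> p" for p by (simp add: \<Phi>_def bump_nonneg)
  moreover have "q \<in> U" using q r by (simp add: U_def)
  ultimately show ?thesis using that[of \<Phi> K U] K zero by blast
qed

text \<open>\<open>integral_form\<close> selects a partition by \<open>SOME\<close>, which says
  nothing before existence is known. Compactness provides finitely many bump functions with positive
  sum, and dividing by the sum normalises them.\<close>

lemma partition_of_unity_exists: "\<exists>F \<rho>. partition_of_unity X A F \<rho>"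
proof -
  have "\<forall>q\<in>topspace X. \<exists>c \<Phi> K U. c \<in> A \<and> smooth_function A \<Phi> \<and> (\<forall>p. 0 \<le> \<Phi> p) \<and> closedin X K \<and>
      K \<subseteq> chart_dom c \<and> (\<forall>p \<in> topspace X - K. \<Phi> p = 0) \<and> openin X U \<and> q \<in> U \<and> (\<forall>p \<in> U. \<Phi> p > (0::real))"
    (is "\<forall>q\<in>_. \<exists>c \<Phi> K U. ?P q c \<Phi> K U")
  proof
    fix q assume "q \<in> topspace X"
    then obtain c where c: "c \<in> A" "q \<in> chart_dom c" using chart_cover by blast
    show "\<exists>c \<Phi> K U. ?P q c \<Phi> K U"
      by (rule bump_function_exists[OF c], rule exI[of _ c]) (use c in blast)
  qed
  from bchoice[OF this] obtain c where "\<forall>q\<in>topspace X. \<exists>\<Phi> K U. ?P q (c q) \<Phi> K U" ..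
  from bchoice[OF this] obtain \<Phi> where "\<forall>q\<in>topspace X. \<exists>K U. ?P q (c q) (\<Phi> q) K U" ..
  from bchoice[OF this] obtain K where "\<forall>q\<in>topspace X. \<exists>U. ?P q (c q) (\<Phi> q) (K q) U" ..
  from bchoice[OF this] obtain U where P: "\<forall>q\<in>topspace X. ?P q (c q) (\<Phi> q) (K q) (U q)" ..
  have "\<exists>\<C>. finite \<C> \<and> \<C> \<subseteq> U ` topspace X \<and> topspace X \<subseteq> \<Union>\<C>"
    using compact P unfolding compact_space_alt by (elim allE[of _ "U ` topspace X"]) blast
  then obtain \<C> where \<C>: "finite \<C>" "\<C> \<subseteq> U ` topspace X" "topspace X \<subseteq> \<Union>\<C>" by blast
  from finite_subset_image[OF \<C>(1,2)] obtain Q where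
    Q: "finite Q" "Q \<subseteq> topspace X" "topspace X \<subseteq> (\<Union>q\<in>Q. U q)"
    using \<C>(3) by blast
  have PQ: "?P q (c q) (\<Phi> q) (K q) (U q)" if "q \<in> Q" for q
    using P Q(2) that by (elim ballE[of _ _ q]) auto
  define s where "s p = (\<Sum>q\<in>Q. \<Phi> q p)" for p
  \<comment> \<open>The partition is indexed by charts, but several points of \<open>Q\<close> may
    share a chart, so their bump functions are added up.\<close>
  define \<rho> where "\<rho> d p = (\<Sum>q\<in>{q\<in>Q. c q = d}. \<Phi> q p) / s p" for d p
  have s_pos: "s p > 0" if "p \<in> topspace X" for p
  proof -
    from that Q(3) obtain q where "q \<in> Q" "p \<in> U q" by blast
    then have "0 < \<Phi> q p" using PQ by blast
    then show ?thesis unfolding s_def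
      using \<open>q \<in> Q\<close> Q(1) PQ by (intro sum_pos2[of _ q]) auto
  qed
  have "partition_of_unity X A (c ` Q) \<rho>"
    unfolding partition_of_unity_def
  proof (intro conjI ballI)
    show "finite (c ` Q)" using Q by simp
    show "c ` Q \<subseteq> A" using PQ by blast
    show "(\<Sum>d\<in>c ` Q. \<rho> d p) = 1" if "p \<in> topspace X" for p
    proof -
      have "(\<Sum>d\<in>c ` Q. \<rho> d p) = (\<Sum>d\<in>c ` Q. \<Sum>q\<in>{q\<in>Q. c q = d}. \<Phi> q p) / s p"
        unfolding \<rho>_def by (simp add: sum_divide_distrib)
      also have "\<dots> = s p / s p"
        unfolding s_def using sum.image_gen[OF Q(1), of "\<lambda>q. \<Phi> q p" c] by simp
      finally show ?thesis using s_pos[OF that] by simp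
    qed
    fix d assume d: "d \<in> c ` Q"
    show "0 \<le> \<rho> d p" if "p \<in> topspace X" for p
      unfolding \<rho>_def using s_pos[OF that] PQ by (auto intro!: divide_nonneg_pos sum_nonneg)
    show "smooth_function A (\<rho> d)"
      unfolding smooth_function_def
    proof
      fix e assume e: "e \<in> A"
      note op = open_chart_range[OF e]
      have sm: "smooth_on (chart_range e) (\<lambda>x. \<Phi> q (chart_inv e x))" if "q \<in> Q" for q
        using PQ[OF that] e unfolding smooth_function_def by blast
      show "smooth_on (chart_range e) (\<lambda>x. \<rho> d (chart_inv e x))"
        unfolding \<rho>_def s_def
      proof (rule smooth_on_divide[OF op])
        show "(\<Sum>q\<in>Q. \<Phi> q (chart_inv e x)) \<noteq> 0" if "x \<in> chart_range e" for x
          using s_pos[of "chart_inv e x"] chart_inv_in_dom[OF e that] chart_dom_subset[OF e]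
          by (auto simp: s_def)
        show "smooth_on (chart_range e) (\<lambda>x. \<Sum>q\<in>{q\<in>Q. c q = d}. \<Phi> q (chart_inv e x))"
          by (rule smooth_on_sum[OF op]) (simp add: sm)
        show "smooth_on (chart_range e) (\<lambda>x. \<Sum>q\<in>Q. \<Phi> q (chart_inv e x))"
          by (rule smooth_on_sum[OF op]) (simp add: sm)
      qed
    qed
    \<comment> \<open>A finite union of closed sets inside the chart, so the support stays inside
      even after taking its closure.\<close>
    let ?K = "\<Union>q\<in>{q\<in>Q. c q = d}. K q"
    have "closedin X ?K" using Q PQ by (intro closedin_Union) (auto simp del: UN_simps)
    moreover have "{p \<in> topspace X. \<rho> d p \<noteq> 0} \<subseteq> ?K"
    proof
      fix p assume p: "p \<in> {p \<in> topspace X. \<rho> d p \<noteq> 0}"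
      then have "(\<Sum>q\<in>{q\<in>Q. c q = d}. \<Phi> q p) \<noteq> 0" by (auto simp: \<rho>_def)
      then have "\<exists>q\<in>{q\<in>Q. c q = d}. \<Phi> q p \<noteq> 0" by (meson sum.neutral)
      then obtain q where "q \<in> Q" "c q = d" "\<Phi> q p \<noteq> 0" by auto
      then show "p \<in> ?K" using PQ[of q] p by auto
    qed
    ultimately have "X closure_of {p \<in> topspace X. \<rho> d p \<noteq> 0} \<subseteq> ?K"
      by (simp add: closure_of_minimal)
    also have "?K \<subseteq> chart_dom d" using PQ by (intro UN_least) auto
    finally show "X closure_of {p \<in> topspace X. \<rho> d p \<noteq> 0} \<subseteq> chart_dom d" .
  qed
  then show ?thesis by blast
qed

end


section \<open>Differential forms in charts\<close>

lemma linear_field_sum_Basis: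
  fixes b :: "'a \<Rightarrow> 'b::euclidean_space \<Rightarrow> 'c::real_vector"
  assumes "\<And>z. z \<in> S \<Longrightarrow> linear (b z)" "z \<in> S"
  shows "b z v = (\<Sum>i\<in>Basis. (v \<bullet> i) *\<^sub>R b z i)"
  using linear_eq_sum_Basis assms by blast

lemma linear_field_derivative_sum_Basis:
  fixes b :: "'a::real_normed_vector \<Rightarrow> 'b::euclidean_space \<Rightarrow> 'c::real_normed_vector"
  assumes S: "open S" "x \<in> S" and b: "\<And>z. z \<in> S \<Longrightarrow> linear (b z)" "\<And>v. smooth_on S (\<lambda>z. b z v)"
  shows "frechet_derivative (\<lambda>z. b z v) (at x) u =
    (\<Sum>i\<in>Basis. (v \<bullet> i) *\<^sub>R frechet_derivative (\<lambda>z. b z i) (at x) u)"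
proof (rule frechet_derivative_eqI)
  have "((\<lambda>z. \<Sum>i\<in>Basis. (v \<bullet> i) *\<^sub>R b z i) has_derivative
      (\<lambda>u. \<Sum>i\<in>Basis. (v \<bullet> i) *\<^sub>R frechet_derivative (\<lambda>z. b z i) (at x) u)) (at x)"
    by (intro has_derivative_sum has_derivative_scaleR_right smooth_on_has_derivative[OF b(2) S(2)])
  then show "((\<lambda>z. b z v) has_derivative
      (\<lambda>u. \<Sum>i\<in>Basis. (v \<bullet> i) *\<^sub>R frechet_derivative (\<lambda>z. b z i) (at x) u)) (at x)"
    by (rule has_derivative_transform_within_open[OF _ S]) (rule linear_field_sum_Basis[OF b(1), symmetric])
qed

lemma linear_linear_field_derivative:
  fixes b :: "'a::real_normed_vector \<Rightarrow> 'b::euclidean_space \<Rightarrow> 'c::real_normed_vector"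
  assumes "open S" "x \<in> S" "\<And>z. z \<in> S \<Longrightarrow> linear (b z)" "\<And>v. smooth_on S (\<lambda>z. b z v)"
  shows "linear (\<lambda>v. frechet_derivative (\<lambda>z. b z v) (at x) u)"
  by (subst linear_field_derivative_sum_Basis[OF assms])
    (auto intro!: linearI simp: inner_add_left scaleR_add_left sum.distrib scaleR_sum_right)

text \<open>The product rule when base point and vector both move. For a pullback these are the
  image under the transition map and the pushed-forward vector.\<close>

lemma linear_field_has_derivative:
  fixes b :: "'c::real_normed_vector \<Rightarrow> 'b::euclidean_space \<Rightarrow> 'd::real_normed_vector"
    and \<tau> :: "'a::real_normed_vector \<Rightarrow> 'c"
  assumes S: "open S" "\<tau> x \<in> S" and b: "\<And>z. z \<in> S \<Longrightarrow> linear (b z)" "\<And>v. smooth_on S (\<lambda>z. b z v)"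
    and \<tau>: "open U" "x \<in> U" "\<tau> ` U \<subseteq> S" "(\<tau> has_derivative \<tau>') (at x)"
    and w: "(w has_derivative w') (at x)"
  shows "((\<lambda>y. b (\<tau> y) (w y)) has_derivative
    (\<lambda>u. frechet_derivative (\<lambda>z. b z (w x)) (at (\<tau> x)) (\<tau>' u) + b (\<tau> x) (w' u))) (at x)"
proof -
  have "((\<lambda>y. b (\<tau> y) i) has_derivative (\<lambda>u. frechet_derivative (\<lambda>z. b z i) (at (\<tau> x)) (\<tau>' u))) (at x)" for i
    by (rule has_derivative_compose[OF \<tau>(4) smooth_on_has_derivative[OF b(2) S(2)]])
  then have "((\<lambda>y. \<Sum>i\<in>Basis. (w y \<bullet> i) *\<^sub>R b (\<tau> y) i) has_derivative
      (\<lambda>u. \<Sum>i\<in>Basis. (w x \<bullet> i) *\<^sub>R frechet_derivative (\<lambda>z. b z i) (at (\<tau> x)) (\<tau>' u) +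
        (w' u \<bullet> i) *\<^sub>R b (\<tau> x) i)) (at x)"
    by (intro has_derivative_sum has_derivative_scaleR has_derivative_inner_left w)
  then have "((\<lambda>y. b (\<tau> y) (w y)) has_derivative
      (\<lambda>u. \<Sum>i\<in>Basis. (w x \<bullet> i) *\<^sub>R frechet_derivative (\<lambda>z. b z i) (at (\<tau> x)) (\<tau>' u) +
        (w' u \<bullet> i) *\<^sub>R b (\<tau> x) i)) (at x)"
    by (rule has_derivative_transform_within_open[OF _ \<tau>(1,2)])
      (use \<tau>(3) in \<open>auto intro!: linear_field_sum_Basis[OF b(1), symmetric]\<close>)
  moreover have "(\<Sum>i\<in>Basis. (w x \<bullet> i) *\<^sub>R frechet_derivative (\<lambda>z. b z i) (at (\<tau> x)) (\<tau>' u) +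
      (w' u \<bullet> i) *\<^sub>R b (\<tau> x) i) =
      frechet_derivative (\<lambda>z. b z (w x)) (at (\<tau> x)) (\<tau>' u) + b (\<tau> x) (w' u)" for u
    by (simp only: sum.distrib linear_field_derivative_sum_Basis[OF S b, symmetric]
        linear_eq_sum_Basis[OF b(1)[OF S(2)], symmetric])
  ultimately show ?thesis by simp
qed

section \<open>Three-forms in coordinates\<close>

definition trilinear_det :: "real^3 \<Rightarrow> real^3 \<Rightarrow> real^3 \<Rightarrow> real" where
  "trilinear_det u v w = det (\<chi> i j. if j = 1 then u $ i else if j = 2 then v $ i else w $ i)"

lemma real3_expand: "(v :: real^3) = v $ 1 *\<^sub>R axis 1 1 + v $ 2 *\<^sub>R axis 2 1 + v $ 3 *\<^sub>R axis 3 1"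
  by (simp add: vec_eq_iff forall_3 axis_def)

lemma linear_real3_expand:
  fixes f :: "real^3 \<Rightarrow> 'a::real_vector"
  assumes "linear f"
  shows "f v = v $ 1 *\<^sub>R f (axis 1 1) + v $ 2 *\<^sub>R f (axis 2 1) + v $ 3 *\<^sub>R f (axis 3 1)"
proof -
  have "f v = f (v $ 1 *\<^sub>R axis 1 1 + v $ 2 *\<^sub>R axis 2 1 + v $ 3 *\<^sub>R axis 3 1)"
    using real3_expand[of v] by simp
  then show ?thesis by (simp add: linear_add[OF assms] linear_scale[OF assms])
qed

text \<open>Alternating 3-forms on a three-dimensional space are multiples of the determinant.
  \<open>\<beta>\<close> is an abstract antisymmetric bilinear form, so that an exterior derivative
  and a product of two 1-forms both qualify.\<close>

lemma wedge12_eq_det: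
  assumes \<alpha>: "linear (\<alpha> c x)" and \<beta>: "\<And>v. linear (\<lambda>u. \<beta> c x u v)" "\<And>u v. \<beta> c x v u = - \<beta> c x u v"
  shows "wedge12 \<alpha> \<beta> c x u v w = trilinear_det u v w * wedge12 \<alpha> \<beta> c x (axis 1 1) (axis 2 1) (axis 3 1)"
proof -
  let ?e1 = "axis 1 1 :: real^3" and ?e2 = "axis 2 1 :: real^3" and ?e3 = "axis 3 1 :: real^3"
  have diag: "\<beta> c x u u = 0" for u using \<beta>(2)[of u u] by simp
  have \<beta>2: "linear (\<lambda>v. \<beta> c x u v)" for u
    using linear_compose_neg[OF \<beta>(1)[of u]] \<beta>(2)[of u] by simp
  have b: "\<beta> c x u v = (u $ 1 * v $ 2 - u $ 2 * v $ 1) * \<beta> c x ?e1 ?e2 +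
      (u $ 2 * v $ 3 - u $ 3 * v $ 2) * \<beta> c x ?e2 ?e3 + (u $ 3 * v $ 1 - u $ 1 * v $ 3) * \<beta> c x ?e3 ?e1"
    (is "_ = ?r u v") for u v
  proof -
    have e: "\<beta> c x ?e2 ?e1 = - \<beta> c x ?e1 ?e2" "\<beta> c x ?e3 ?e2 = - \<beta> c x ?e2 ?e3"
      "\<beta> c x ?e1 ?e3 = - \<beta> c x ?e3 ?e1"
      using \<beta>(2) by blast+
    have v: "\<beta> c x ?e1 v = v $ 2 * \<beta> c x ?e1 ?e2 - v $ 3 * \<beta> c x ?e3 ?e1"
      "\<beta> c x ?e2 v = v $ 3 * \<beta> c x ?e2 ?e3 - v $ 1 * \<beta> c x ?e1 ?e2"
      "\<beta> c x ?e3 v = v $ 1 * \<beta> c x ?e3 ?e1 - v $ 2 * \<beta> c x ?e2 ?e3"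
      using linear_real3_expand[OF \<beta>2[of ?e1], of v] linear_real3_expand[OF \<beta>2[of ?e2], of v]
        linear_real3_expand[OF \<beta>2[of ?e3], of v]
      by (simp_all add: diag e)
    have "\<beta> c x u v = u $ 1 * \<beta> c x ?e1 v + u $ 2 * \<beta> c x ?e2 v + u $ 3 * \<beta> c x ?e3 v"
      using linear_real3_expand[OF \<beta>(1)[of v], of u] by simp
    also have "\<dots> = ?r u v" unfolding v by (simp add: algebra_simps)
    finally show ?thesis .
  qed
  have a: "\<alpha> c x u = u $ 1 * \<alpha> c x ?e1 + u $ 2 * \<alpha> c x ?e2 + u $ 3 * \<alpha> c x ?e3" for u
    using linear_real3_expand[OF \<alpha>, of u] by simp
  show ?thesis
    unfolding wedge12_def a[of u] a[of v] a[of w] b[of v w] b[of w u] b[of u v] trilinear_det_def det_3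
    by (simp add: algebra_simps)
qed

text \<open>The coefficient of \<eta> \<and> d\<eta> relative to the coordinate volume; for the
  \<eta> of \<open>gv\<close> it is the integrand before weighting by the partition.\<close>

definition wedge_density :: "'a form1 \<Rightarrow> 'a chart \<Rightarrow> real^3 \<Rightarrow> real" where
  "wedge_density \<eta> c x = wedge12 \<eta> (ext_deriv \<eta>) c x (axis 1 1) (axis 2 1) (axis 3 1)"

lemma ext_deriv_antisym: "ext_deriv \<omega> c x v u = - ext_deriv \<omega> c x u v"
  by (simp add: ext_deriv_def)

text \<open>Used with three kinds of factor: \<open>t = 1\<close> says that d is local,
  \<open>t = 0\<close> that it vanishes on a form vanishing on an open set, and a general
  \<open>t\<close> treats a rescaled form.\<close>

lemma ext_deriv_scaled:
  assumes S: "open S" "x \<in> S" and \<eta>: "\<And>v. smooth_on S (\<lambda>y. \<eta> c y v)"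
    and eq: "\<And>y v. y \<in> S \<Longrightarrow> \<eta>' c y v = t * \<eta> c y v"
  shows "ext_deriv \<eta>' c x u v = t * ext_deriv \<eta> c x u v"
proof -
  have "frechet_derivative (\<lambda>y. \<eta>' c y v) (at x) u = t * frechet_derivative (\<lambda>y. \<eta> c y v) (at x) u" for u v
  proof (rule frechet_derivative_eqI)
    have "((\<lambda>y. t * \<eta> c y v) has_derivative (\<lambda>u. t * frechet_derivative (\<lambda>y. \<eta> c y v) (at x) u)) (at x)"
      by (intro has_derivative_mult_right smooth_on_has_derivative[OF \<eta> S(2)])
    then show "((\<lambda>y. \<eta>' c y v) has_derivative (\<lambda>u. t * frechet_derivative (\<lambda>y. \<eta> c y v) (at x) u)) (at x)"
      by (rule has_derivative_transform_within_open[OF _ S]) (simp add: eq)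
  qed
  then show ?thesis by (simp add: ext_deriv_def algebra_simps)
qed

lemma wedge_density_scaled:
  assumes S: "open S" "x \<in> S" and \<eta>: "\<And>v. smooth_on S (\<lambda>y. \<eta> c y v)"
    and eq: "\<And>y v. y \<in> S \<Longrightarrow> \<eta>' c y v = t * \<eta> c y v"
  shows "wedge_density \<eta>' c x = t\<^sup>2 * wedge_density \<eta> c x"
proof -
  have "ext_deriv \<eta>' c x u v = t * ext_deriv \<eta> c x u v" for u v
    by (rule ext_deriv_scaled[of S x \<eta> c \<eta>' t, OF S]) (rule \<eta>, rule eq)
  then show ?thesis
    unfolding wedge_density_def wedge12_def eq[OF S(2)] by (simp add: algebra_simps power2_eq_square)
qed

text \<open>Every vector is a multiple of T plus a kernel element, so the kernel and the value on T
  determine the form. Thus \<open>gv\<close> recovers the 1-form of a variation from its plane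
  field.\<close>

lemma form_of_ker_form:
  assumes "linear (\<omega> c x)" "\<omega> c x (T c x) = 1"
  shows "form_of (ker_form \<omega>) T c x = \<omega> c x"
  unfolding form_of_def
proof (rule the_equality)
  show "linear (\<omega> c x) \<and> {v. \<omega> c x v = 0} = ker_form \<omega> c x \<and> \<omega> c x (T c x) = 1"
    using assms by (simp add: ker_form_def)
  fix a :: "real^3 \<Rightarrow> real" assume a: "linear a \<and> {v. a v = 0} = ker_form \<omega> c x \<and> a (T c x) = 1"
  show "a = \<omega> c x"
  proof
    fix v
    have "\<omega> c x (v - \<omega> c x v *\<^sub>R T c x) = 0"
      using assms by (simp add: linear_diff linear_scale)
    then have "a (v - \<omega> c x v *\<^sub>R T c x) = 0" using a by (auto simp: ker_form_def)
    then show "a v = \<omega> c x v" using a by (simp add: linear_diff linear_scale)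
  qed
qed

section \<open>Exterior derivative and densities under coordinate changes\<close>

context closed_manifold
begin

context
  fixes \<omega> :: "'a form1" and c assumes \<omega>: "one_form A \<omega>" and c: "c \<in> A"
begin

lemma one_form_linear: "x \<in> chart_range c \<Longrightarrow> linear (\<omega> c x)"
  and one_form_smooth: "smooth_on (chart_range c) (\<lambda>x. \<omega> c x v)"
  using \<omega> c by (auto simp: one_form_def)

lemma linear_ext_deriv:
  assumes "x \<in> chart_range c"
  shows "linear (\<lambda>u. ext_deriv \<omega> c x u v)"
  unfolding ext_deriv_def
  by (intro linear_compose_sub linear_frechet_derivative smooth_on_imp_differentiable[OF _ assms]
      one_form_smooth linear_linear_field_derivative[OF open_chart_range[OF c] assms one_form_linear])

lemma linear_ext_deriv_right:
  assumes "x \<in> chart_range c"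
  shows "linear (ext_deriv \<omega> c x u)"
proof -
  have "ext_deriv \<omega> c x u = (\<lambda>v. - ext_deriv \<omega> c x v u)" by (rule ext) (rule ext_deriv_antisym)
  then show ?thesis using linear_compose_neg[OF linear_ext_deriv[OF assms, of u]] by simp
qed

lemma smooth_on_ext_deriv: "smooth_on (chart_range c) (\<lambda>x. ext_deriv \<omega> c x u v)"
  unfolding ext_deriv_def
  by (intro smooth_on_diff smooth_on_frechet_derivative one_form_smooth open_chart_range[OF c])

lemma wedge_density_continuous_on: "continuous_on (chart_range c) (wedge_density \<omega> c)"
proof -
  have "smooth_on (chart_range c) (wedge_density \<omega> c)"
    unfolding wedge_density_def wedge12_def
    by (intro smooth_on_add smooth_on_mult smooth_on_ext_deriv one_form_smooth open_chart_range[OF c])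
  then show ?thesis by (rule smooth_on_imp_continuous_on)
qed

end

text \<open>Differentiating the transformation law of \<omega> leaves an extra term containing the
  second derivative of the transition map; it is symmetric in \<open>u\<close> and \<open>v\<close>
  and cancels in the antisymmetrisation.\<close>

lemma ext_deriv_transition:
  assumes \<omega>: "one_form A \<omega>" and c: "c \<in> A" and d: "d \<in> A" and x: "x \<in> overlap c d"
  shows "ext_deriv \<omega> c x u v =
    ext_deriv \<omega> d (transition c d x) (transition_deriv c d x u) (transition_deriv c d x v)"
proof -
  let ?\<tau> = "transition c d" and ?J = "transition_deriv c d"
  let ?H = "\<lambda>u v. frechet_derivative (\<lambda>y. ?J y v) (at x) u"
  have op: "open (overlap c d)" by (rule open_overlap[OF c d])
  have range: "?\<tau> ` overlap c d \<subseteq> chart_range d"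
    using transition_in_overlap[OF c d] overlap_iff[OF d] by blast
  have D: "frechet_derivative (\<lambda>y. \<omega> c y v) (at x) u =
      frechet_derivative (\<lambda>z. \<omega> d z (?J x v)) (at (?\<tau> x)) (?J x u) + \<omega> d (?\<tau> x) (?H u v)" for u v
  proof (rule frechet_derivative_eqI)
    have "((\<lambda>y. \<omega> d (?\<tau> y) (?J y v)) has_derivative
        (\<lambda>u. frechet_derivative (\<lambda>z. \<omega> d z (?J x v)) (at (?\<tau> x)) (?J x u) + \<omega> d (?\<tau> x) (?H u v))) (at x)"
    proof (rule linear_field_has_derivative[OF open_chart_range[OF d] _ one_form_linear[OF \<omega> d]
          one_form_smooth[OF \<omega> d] op x range])
      show "?\<tau> x \<in> chart_range d" using range x by blast
      show "(?\<tau> has_derivative ?J x) (at x)" by (rule transition_has_derivative[OF c d x])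
      show "((\<lambda>y. ?J y v) has_derivative (\<lambda>u. ?H u v)) (at x)"
        by (rule smooth_on_has_derivative[OF smooth_on_frechet_derivative[OF transition_smooth[OF c d]] x])
    qed
    then show "((\<lambda>y. \<omega> c y v) has_derivative
        (\<lambda>u. frechet_derivative (\<lambda>z. \<omega> d z (?J x v)) (at (?\<tau> x)) (?J x u) + \<omega> d (?\<tau> x) (?H u v))) (at x)"
      by (rule has_derivative_transform_within_open[OF _ op x])
        (use \<omega> c d in \<open>simp add: one_form_def\<close>)
  qed
  have "?H u v = ?H v u"
    by (rule second_derivative_commute[OF op x transition_smooth[OF c d]])
  then show ?thesis unfolding ext_deriv_def D[of u v] D[of v u] by simp
qed

lemma one_form_interior_prod:
  assumes \<omega>: "one_form A \<omega>" and V: "vector_field A V"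
  shows "one_form A (interior_prod V (ext_deriv \<omega>))"
  unfolding one_form_def interior_prod_def
proof (intro conjI ballI allI)
  fix c v assume c: "c \<in> A"
  show "linear (\<lambda>v. ext_deriv \<omega> c x (V c x) v)" if "x \<in> chart_range c" for x
    using linear_ext_deriv_right[OF \<omega> c that] by simp
  show "smooth_on (chart_range c) (\<lambda>x. ext_deriv \<omega> c x (V c x) v)"
  proof (rule smooth_on_linear_fields[OF open_chart_range[OF c], of "\<lambda>x u. ext_deriv \<omega> c x u v"])
    show "linear (\<lambda>u. ext_deriv \<omega> c x u v)" if "x \<in> chart_range c" for x
      by (rule linear_ext_deriv[OF \<omega> c that])
    show "smooth_on (chart_range c) (\<lambda>x. ext_deriv \<omega> c x u v)" for u
      by (rule smooth_on_ext_deriv[OF \<omega> c])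
    show "smooth_on (chart_range c) (V c)" using V c by (simp add: vector_field_def)
  qed
  fix d x assume d: "d \<in> A" and x: "x \<in> overlap c d"
  have "V d (transition c d x) = transition_deriv c d x (V c x)"
    using V c d x by (simp add: vector_field_def)
  then show "ext_deriv \<omega> c x (V c x) v =
      ext_deriv \<omega> d (transition c d x) (V d (transition c d x)) (transition_deriv c d x v)"
    by (simp only: ext_deriv_transition[OF \<omega> c d x])
qed

text \<open>The factor is positive on an oriented atlas, so the sign of the density belongs to the
  point and not to the chart.\<close>

lemma wedge_density_transition:
  assumes \<omega>: "one_form A \<omega>" and c: "c \<in> A" and d: "d \<in> A" and x: "x \<in> overlap c d"
  shows "wedge_density \<omega> c x = det (matrix (transition_deriv c d x)) * wedge_density \<omega> d (transition c d x)"
proof -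
  let ?y = "transition c d x" and ?J = "transition_deriv c d x"
  let ?e1 = "axis 1 1 :: real^3" and ?e2 = "axis 2 1 :: real^3" and ?e3 = "axis 3 1 :: real^3"
  have y: "?y \<in> chart_range d" using transition_in_overlap[OF c d x] overlap_iff[OF d] by blast
  have "wedge_density \<omega> c x = wedge12 \<omega> (ext_deriv \<omega>) d ?y (?J ?e1) (?J ?e2) (?J ?e3)"
  proof -
    have "\<omega> c x v = \<omega> d ?y (?J v)" for v using \<omega> c d x by (simp add: one_form_def)
    then show ?thesis
      by (simp only: wedge_density_def wedge12_def ext_deriv_transition[OF \<omega> c d x])
  qed
  also have "\<dots> = trilinear_det (?J ?e1) (?J ?e2) (?J ?e3) * wedge_density \<omega> d ?y"
    unfolding wedge_density_def
    by (rule wedge12_eq_det[of \<omega> d ?y "ext_deriv \<omega>"])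
      (rule one_form_linear[OF \<omega> d y] linear_ext_deriv[OF \<omega> d y] ext_deriv_antisym)+
  also have "trilinear_det (?J ?e1) (?J ?e2) (?J ?e3) = det (matrix ?J)"
    unfolding trilinear_det_def matrix_def det_3 by simp
  finally show ?thesis .
qed


end


section \<open>Integrals of 3-forms\<close>

lemma set_integrable_compact_support:
  fixes f :: "'a::euclidean_space \<Rightarrow> real"
  assumes "open U" "continuous_on U f" "compact K" "K \<subseteq> U" "\<And>x. x \<in> U - K \<Longrightarrow> f x = 0"
  shows "set_integrable lborel U f"
proof -
  have "set_integrable lborel K f"
    unfolding set_integrable_def
    using borel_integrable_compact[OF assms(3) continuous_on_subset[OF assms(2,4)]] .
  moreover have "(\<lambda>x. indicator U x *\<^sub>R f x) = (\<lambda>x. indicator K x *\<^sub>R f x)"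
    using assms(4,5) by (auto simp: indicator_def fun_eq_iff)
  ultimately show ?thesis unfolding set_integrable_def by simp
qed

lemma set_integral_bound_compact_support:
  fixes f :: "'a::euclidean_space \<Rightarrow> real"
  assumes "compact K" "K \<subseteq> U" "\<And>x. x \<in> U - K \<Longrightarrow> f x = 0" "\<And>x. x \<in> K \<Longrightarrow> \<bar>f x\<bar> \<le> B"
  shows "\<bar>LINT x:U|lborel. f x\<bar> \<le> B * measure lborel K"
proof (cases "set_integrable lborel U f")
  case True
  have "\<bar>LINT x:U|lborel. f x\<bar> \<le> (LINT x|lborel. indicator K x * B)"
    unfolding set_lebesgue_integral_def real_norm_def[symmetric]
  proof (rule Bochner_Integration.integral_norm_bound_integral)
    show "integrable lborel (\<lambda>x. indicator U x *\<^sub>R f x)" using True by (simp add: set_integrable_def)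
    show "integrable lborel (\<lambda>x. indicator K x * B)"
      using borel_integrable_compact[OF assms(1), of "\<lambda>_. B"] by simp
    show "norm (indicator U x *\<^sub>R f x) \<le> indicator K x * B" for x
      using assms(2-4) by (auto simp: indicator_def)
  qed
  also have "\<dots> = B * measure lborel K"
    using assms(1) by (simp add: compact_imp_closed borel_closed)
  finally show ?thesis .
next
  case False
  \<comment> \<open>A non-integrable function has the default integral 0, and the claimed bound is
    nonnegative.\<close>
  then have "(LINT x:U|lborel. f x) = 0"
    by (simp add: set_integrable_def set_lebesgue_integral_def not_integrable_integral_eq)
  moreover have "0 \<le> B * measure lborel K"
  proof (cases "K = {}")
    case False
    then show ?thesis using assms(4) by (fastforce intro: mult_nonneg_nonneg)
  qed simp
  ultimately show ?thesis by simp
qed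

text \<open>Continuity keeps \<open>f\<close> above half of its value at \<open>x\<close> on a small
  ball, and balls have positive measure.\<close>

lemma set_integral_pos:
  fixes f :: "'a::euclidean_space \<Rightarrow> real"
  assumes U: "open U" "continuous_on U f" and int: "set_integrable lborel U f"
    and nonneg: "\<And>x. x \<in> U \<Longrightarrow> 0 \<le> f x" and x: "x \<in> U" "f x > 0"
  shows "(LINT x:U|lborel. f x) > 0"
proof -
  have "isCont f x" using U x continuous_on_eq_continuous_at by blast
  then have "\<exists>d>0. \<forall>y. dist y x < d \<longrightarrow> \<bar>f y - f x\<bar> < f x / 2"
    using x(2) unfolding continuous_at_eps_delta dist_real_def
    by (elim allE[of _ "f x / 2"]) simp
  then obtain d where d: "d > 0" "\<And>y. dist y x < d \<Longrightarrow> \<bar>f y - f x\<bar> < f x / 2" by blast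
  obtain e where e: "e > 0" "ball x e \<subseteq> U" using U x open_contains_ball by blast
  define B where "B = ball x (min d e)"
  have BU: "B \<subseteq> U" using e by (auto simp: B_def)
  have fB: "f x / 2 \<le> f y" if "y \<in> B" for y
  proof -
    have "\<bar>f y - f x\<bar> < f x / 2" using d(2)[of y] that by (simp add: B_def dist_commute)
    then show ?thesis by arith
  qed
  have fin: "emeasure lborel B < \<infinity>" unfolding B_def using emeasure_lborel_ball_finite by simp
  have "0 < measure lborel B"
    using d e content_ball_pos[of "min d e" x] by (simp add: B_def)
  then have "0 < (f x / 2) * measure lborel B" using x by simp
  also have "\<dots> = (LINT y|lborel. indicator B y * (f x / 2))"
    by (simp add: B_def)
  also have "\<dots> \<le> (LINT y:U|lborel. f y)"
    unfolding set_lebesgue_integral_def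
  proof (rule integral_mono)
    show "integrable lborel (\<lambda>y. indicator B y * (f x / 2))"
      using fin by (simp add: B_def)
    show "integrable lborel (\<lambda>y. indicator U y *\<^sub>R f y)" using int by (simp add: set_integrable_def)
    show "indicator B y * (f x / 2) \<le> indicator U y *\<^sub>R f y" for y
      using BU fB[of y] nonneg[of y] by (auto simp: indicator_def)
  qed
  finally show ?thesis .
qed

context closed_manifold
begin

text \<open>One pair \<open>F\<close>, \<open>\<rho>\<close> serves every 3-form, since the
  \<open>SOME\<close> in \<open>integral_form\<close> does not mention \<mu>. Integrals of different
  forms can therefore be compared summand by summand.\<close>

lemma integral_form_partition:
  obtains F \<rho> where "partition_of_unity X A F \<rho>"
    "\<And>\<mu>. integral_form X A \<mu> = (\<Sum>c\<in>F. LINT x:chart_range c|lborel.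
      \<rho> c (chart_inv c x) * \<mu> c x (axis 1 1) (axis 2 1) (axis 3 1))"
proof -
  obtain F \<rho> where P: "(SOME (F, \<rho>). partition_of_unity X A F \<rho>) = (F, \<rho>)" by (rule prod.exhaust)
  have "\<exists>P. case P of (F, \<rho>) \<Rightarrow> partition_of_unity X A F \<rho>"
    using partition_of_unity_exists by simp
  then have "case (F, \<rho>) of (F, \<rho>) \<Rightarrow> partition_of_unity X A F \<rho>"
    unfolding P[symmetric] by (rule someI_ex)
  then show ?thesis
    by (intro that[of F \<rho>]) (simp_all add: integral_form_def P)
qed

text \<open>The closed support lies in a compact space and inside the chart, so its coordinate image
  is compact. This reduces integrals over an open, possibly unbounded, chart range to compact
  sets.\<close>

lemma partition_compact_support:
  assumes P: "partition_of_unity X A F \<rho>" and c: "c \<in> F"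
  obtains K where "compact K" "K \<subseteq> chart_range c"
    "\<And>x. x \<in> chart_range c - K \<Longrightarrow> \<rho> c (chart_inv c x) = 0"
proof -
  have cA: "c \<in> A" using P c by (auto simp: partition_of_unity_def)
  let ?S = "{p \<in> topspace X. \<rho> c p \<noteq> 0}"
  have S: "X closure_of ?S \<subseteq> chart_dom c" using P c by (simp add: partition_of_unity_def)
  show ?thesis
  proof (rule that[of "chart_map c ` (X closure_of ?S)"])
    show "compact (chart_map c ` (X closure_of ?S))" by (rule compact_chart_image[OF cA _ S]) simp
    show "chart_map c ` (X closure_of ?S) \<subseteq> chart_range c" using S by (auto simp: chart_range_def)
    fix x assume x: "x \<in> chart_range c - chart_map c ` (X closure_of ?S)"
    have "chart_inv c x \<notin> X closure_of ?S"
    proof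
      assume "chart_inv c x \<in> X closure_of ?S"
      then have "chart_map c (chart_inv c x) \<in> chart_map c ` (X closure_of ?S)" by (rule imageI)
      then show False using x cA by simp
    qed
    moreover have "?S \<subseteq> X closure_of ?S" by (rule closure_of_subset) auto
    moreover have "chart_inv c x \<in> topspace X"
      using x chart_inv_in_dom[OF cA] chart_dom_subset[OF cA] by blast
    ultimately show "\<rho> c (chart_inv c x) = 0" by blast
  qed
qed

end


section \<open>Contact structures are critical\<close>

lemma frechet_derivative_partial:
  fixes f :: "real \<times> 'a::real_normed_vector \<Rightarrow> 'b::real_normed_vector"
  assumes "f differentiable (at (t, x))"
  shows "frechet_derivative (\<lambda>y. f (t, y)) (at x) u = frechet_derivative f (at (t, x)) (0, u)"
proof (rule frechet_derivative_eqI)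
  have "((\<lambda>y. (t, y)) has_derivative (\<lambda>u. (0, u))) (at x)"
    by (intro has_derivative_Pair has_derivative_const has_derivative_ident)
  moreover have "(f has_derivative frechet_derivative f (at (t, x))) (at (t, x))"
    using assms frechet_derivative_works by blast
  ultimately show "((\<lambda>y. f (t, y)) has_derivative (\<lambda>u. frechet_derivative f (at (t, x)) (0, u))) (at x)"
    by (rule has_derivative_compose)
qed

text \<open>A coordinate derivative at fixed time is the joint derivative in the direction
  \<open>(0, u)\<close>, so it remains smooth jointly in time and position.\<close>

lemma smooth_on_partial:
  fixes f :: "real \<times> 'a::real_normed_vector \<Rightarrow> 'b::real_normed_vector"
  assumes "open S" "smooth_on S f"
  shows "smooth_on S (\<lambda>(t, x). frechet_derivative (\<lambda>y. f (t, y)) (at x) u)"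
proof -
  have "frechet_derivative f (at p) (0, u) = (\<lambda>(t, x). frechet_derivative (\<lambda>y. f (t, y)) (at x) u) p"
    if "p \<in> S" for p
    using that smooth_on_imp_differentiable[OF assms(2)]
    by (cases p) (simp add: frechet_derivative_partial)
  then show ?thesis
    using smooth_on_cong[OF assms(1), of "\<lambda>p. frechet_derivative f (at p) (0, u)"]
      smooth_on_frechet_derivative[OF assms(2), of "(0, u)"] by simp
qed

text \<open>The mean value theorem in \<open>t\<close>, with the time derivative bounded by
  compactness. Halving the interval puts a closed time interval inside the open domain.\<close>

lemma smooth_vanishing_at_0_bound:
  fixes f :: "real \<times> 'a::real_normed_vector \<Rightarrow> real"
  assumes "\<epsilon> > 0" and f: "smooth_on ({-\<epsilon><..<\<epsilon>} \<times> U) f"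
    and zero: "\<And>x. x \<in> U \<Longrightarrow> f (0, x) = 0" and K: "compact K" "K \<subseteq> U"
  obtains C where "\<And>t x. \<bar>t\<bar> \<le> \<epsilon> / 2 \<Longrightarrow> x \<in> K \<Longrightarrow> \<bar>f (t, x)\<bar> \<le> C * \<bar>t\<bar>"
proof -
  let ?g = "\<lambda>p. frechet_derivative f (at p) (1, 0)"
  let ?I = "{-\<epsilon>/2..\<epsilon>/2}"
  have sub: "?I \<times> K \<subseteq> {-\<epsilon><..<\<epsilon>} \<times> U" using K(2) \<open>\<epsilon> > 0\<close> by auto
  have "compact (?g ` (?I \<times> K))"
    by (intro compact_continuous_image continuous_on_subset[OF _ sub] compact_Times K compact_Icc
        smooth_on_imp_continuous_on smooth_on_frechet_derivative f)
  then obtain C where C: "\<And>p. p \<in> ?I \<times> K \<Longrightarrow> \<bar>?g p\<bar> \<le> C"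
    using compact_imp_bounded by (fastforce simp: bounded_iff)
  have "\<bar>f (t, x)\<bar> \<le> C * \<bar>t\<bar>" if t: "\<bar>t\<bar> \<le> \<epsilon> / 2" and x: "x \<in> K" for t x
  proof -
    have "norm (f (t, x) - f (0, x)) \<le> C * norm (t - 0)"
    proof (rule field_differentiable_bound[of ?I "\<lambda>s. f (s, x)" "\<lambda>s. ?g (s, x)" C t 0])
      fix s assume s: "s \<in> ?I"
      have "(s, x) \<in> {-\<epsilon><..<\<epsilon>} \<times> U" using sub s x by blast
      then have d: "f differentiable (at ((0, x) + s *\<^sub>R (1, 0)))"
        using smooth_on_imp_differentiable[OF f, of "(s, x)"] by simp
      show "((\<lambda>s. f (s, x)) has_field_derivative ?g (s, x)) (at s within ?I)"
        using has_real_derivative_along_line[OF d] by (simp add: has_field_derivative_at_within)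
      show "norm (?g (s, x)) \<le> C" using C[of "(s, x)"] s x by simp
    qed (use t \<open>\<epsilon> > 0\<close> in auto)
    then show ?thesis using zero[of x] x K by auto
  qed
  then show ?thesis by (rule that)
qed

lemma DERIV_0_of_quadratic_bound:
  fixes f :: "real \<Rightarrow> real"
  assumes "\<delta> > 0" "\<And>t. \<bar>t\<bar> \<le> \<delta> \<Longrightarrow> \<bar>f t\<bar> \<le> C * t\<^sup>2"
  shows "(f has_real_derivative 0) (at 0)"
proof -
  have f0: "f 0 = 0" using assms(2)[of 0] \<open>\<delta> > 0\<close> by simp
  have "((\<lambda>t. (f t - f 0) / (t - 0)) \<longlongrightarrow> 0) (at 0)"
  proof (rule Lim_null_comparison)
    show "\<forall>\<^sub>F t in at 0. norm ((f t - f 0) / (t - 0)) \<le> C * \<bar>t\<bar>"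
      unfolding eventually_at
    proof (intro exI[of _ \<delta>] conjI ballI impI \<open>\<delta> > 0\<close>)
      fix t :: real assume t: "t \<noteq> 0 \<and> dist t 0 < \<delta>"
      then have "\<bar>f t\<bar> \<le> C * t\<^sup>2" by (intro assms(2)) simp
      also have "C * t\<^sup>2 = C * \<bar>t\<bar> * \<bar>t\<bar>"
        by (simp add: power2_eq_square)
      finally show "norm ((f t - f 0) / (t - 0)) \<le> C * \<bar>t\<bar>"
        using t f0 by (simp add: divide_le_eq)
    qed
    have "((\<lambda>t. C * \<bar>t\<bar>) \<longlongrightarrow> C * \<bar>0\<bar>) (at (0::real))" by (intro tendsto_intros)
    then show "((\<lambda>t. C * \<bar>t\<bar>) \<longlongrightarrow> 0) (at (0::real))" by simp
  qed
  then show ?thesis by (simp add: has_field_derivative_iff)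
qed

context closed_manifold
begin

lemma form_of_ker_form_on_chart:
  assumes "one_form A \<omega>" "c \<in> A" "x \<in> chart_range c" "\<omega> c x (T c x) = 1"
  shows "form_of (ker_form \<omega>) T c x = \<omega> c x"
  using form_of_ker_form one_form_linear assms by blast

lemma ext_deriv_form_of_ker_form:
  assumes \<omega>: "one_form A \<omega>" and c: "c \<in> A" and x: "x \<in> chart_range c"
    and T: "\<And>y. y \<in> chart_range c \<Longrightarrow> \<omega> c y (T c y) = 1"
  shows "ext_deriv (form_of (ker_form \<omega>) T) c x u v = ext_deriv \<omega> c x u v"
  using ext_deriv_scaled[of "chart_range c" x \<omega> c "form_of (ker_form \<omega>) T" 1 u v]
    open_chart_range[OF c] x one_form_smooth[OF \<omega> c]
  by (simp add: form_of_ker_form_on_chart[OF \<omega> c] T)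

text \<open>Each term of \<eta>_t \<and> d\<eta>_t is a product of two jointly smooth factors that
  vanish at t = 0, so each factor is O(t) uniformly on \<open>K\<close>.\<close>

lemma variation_density_bound:
  assumes R: "reeb_field A \<omega> T" and \<omega>: "one_form A \<omega>"
    and var: "variation A (ker_form \<omega>) T \<epsilon> \<omega>t Tt"
    and c: "c \<in> A" and K: "compact K" "K \<subseteq> chart_range c"
  obtains C where "\<And>t x. \<bar>t\<bar> \<le> \<epsilon> / 2 \<Longrightarrow> x \<in> K \<Longrightarrow>
    \<bar>wedge_density (interior_prod (Tt t) (ext_deriv (form_of (ker_form (\<omega>t t)) (Tt t)))) c x\<bar> \<le> C * t\<^sup>2"
proof -
  define I where "I = {-\<epsilon><..<\<epsilon>}"
  let ?S = "I \<times> chart_range c"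
  define \<eta> where "\<eta> t = interior_prod (Tt t) (ext_deriv (form_of (ker_form (\<omega>t t)) (Tt t)))" for t
  \<comment> \<open>\<open>H\<close> and \<open>Z\<close> are \<eta>_t and d\<eta>_t written
    directly with \<omega>_t. Joint smoothness in (t, x) can be read off these expressions, but not
    off \<open>form_of\<close>, which is a pointwise \<open>THE\<close>.\<close>
  define H where "H v = (\<lambda>(t, x). ext_deriv (\<omega>t t) c x (Tt t c x) v)" for v
  define Z where "Z u v = (\<lambda>p. (\<lambda>(t, x). frechet_derivative (\<lambda>y. H v (t, y)) (at x) u) p -
      (\<lambda>(t, x). frechet_derivative (\<lambda>y. H u (t, y)) (at x) v) p)" for u v
  have "\<epsilon> > 0" using var by (simp add: variation_def)
  have op: "open ?S" unfolding I_def by (intro open_Times open_chart_range[OF c]) auto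
  have I_iff: "t \<in> I \<longleftrightarrow> \<bar>t\<bar> < \<epsilon>" for t by (auto simp: I_def)
  have \<omega>t: "one_form A (\<omega>t t)" and \<omega>T: "\<And>x. x \<in> chart_range c \<Longrightarrow> \<omega>t t c x (Tt t c x) = 1" if "t \<in> I" for t
    using var that c by (auto simp: variation_def I_iff)
  have smooth: "smooth_on ?S (\<lambda>(t, x). \<omega>t t c x v)" "smooth_on ?S (\<lambda>(t, x). Tt t c x)" for v
    using var c by (auto simp: variation_def I_def)
  have sH: "smooth_on ?S (H v)" for v
  proof -
    have sE: "smooth_on ?S (\<lambda>(t, x). ext_deriv (\<omega>t t) c x u v)" for u
      using smooth_on_diff[OF op smooth_on_partial[OF op smooth(1)[of v], of u]
          smooth_on_partial[OF op smooth(1)[of u], of v]]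
      by (simp add: ext_deriv_def case_prod_beta')
    have "smooth_on ?S (\<lambda>p. (\<lambda>p u. ext_deriv (\<omega>t (fst p)) c (snd p) u v) p ((\<lambda>(t, x). Tt t c x) p))"
    proof (rule smooth_on_linear_fields[OF op _ _ smooth(2)])
      show "linear (\<lambda>u. ext_deriv (\<omega>t (fst p)) c (snd p) u v)" if "p \<in> ?S" for p
        using that by (intro linear_ext_deriv[OF \<omega>t c]) auto
      show "smooth_on ?S (\<lambda>p. ext_deriv (\<omega>t (fst p)) c (snd p) u v)" for u
        using sE[of u] by (simp add: case_prod_beta')
    qed
    then show ?thesis by (simp add: H_def case_prod_beta')
  qed
  have sZ: "smooth_on ?S (Z u v)" for u v
    unfolding Z_def by (intro smooth_on_diff op smooth_on_partial sH)
  have \<eta>H: "\<eta> t c x v = H v (t, x)" if "t \<in> I" "x \<in> chart_range c" for t x v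
    using ext_deriv_form_of_ker_form[OF \<omega>t[OF that(1)] c that(2), where T = "Tt t"] \<omega>T[OF that(1)]
    by (simp add: \<eta>_def H_def interior_prod_def)
  have d\<eta>: "ext_deriv (\<eta> t) c x u v = Z u v (t, x)" if "t \<in> I" "x \<in> chart_range c" for t x u v
  proof -
    have "frechet_derivative (\<lambda>y. \<eta> t c y v) (at x) = frechet_derivative (\<lambda>y. H v (t, y)) (at x)" for v
    proof (rule frechet_derivative_transform_within_open[OF _ open_chart_range[OF c] that(2)])
      have op': "open (chart_range c)" by (rule open_chart_range[OF c])
      have "((\<lambda>y. H v (t, y)) has_derivative (\<lambda>u. frechet_derivative (H v) (at (t, x)) (0, u))) (at x)"
        by (rule has_derivative_compose[of "\<lambda>y. (t, y)" "\<lambda>u. (0, u)" x UNIV "H v"])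
          (use that in \<open>auto intro!: has_derivative_Pair has_derivative_const has_derivative_ident
            smooth_on_has_derivative[OF sH]\<close>)
      then have "((\<lambda>y. \<eta> t c y v) has_derivative (\<lambda>u. frechet_derivative (H v) (at (t, x)) (0, u))) (at x)"
        by (rule has_derivative_transform_within_open[OF _ op' that(2)]) (simp add: \<eta>H that(1))
      then show "(\<lambda>y. \<eta> t c y v) differentiable (at x)" by (auto simp: differentiable_def)
    qed (simp add: \<eta>H that(1))
    then show ?thesis by (simp add: ext_deriv_def Z_def)
  qed
  have \<eta>0: "\<eta> 0 c x v = 0" if "x \<in> chart_range c" for x v
  proof -
    have eq: "\<omega>t 0 c y = \<omega> c y" "Tt 0 c y = T c y" if "y \<in> chart_range c" for y
      using var that c R form_of_ker_form_on_chart[OF \<omega> c that]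
      by (auto simp: variation_def reeb_field_def)
    have "ext_deriv (\<omega>t 0) c x u v = ext_deriv \<omega> c x u v" for u
      using ext_deriv_scaled[of "chart_range c" x \<omega> c "\<omega>t 0" 1 u v]
        open_chart_range[OF c] that one_form_smooth[OF \<omega> c] eq(1) by simp
    then show ?thesis
      using \<eta>H[of 0 x v] that \<open>\<epsilon> > 0\<close> R c eq(2)[OF that]
      by (simp add: I_iff H_def reeb_field_def interior_prod_def)
  qed
  have H0: "H v (0, x) = 0" if "x \<in> chart_range c" for x v
    using \<eta>H[of 0 x v] \<eta>0[OF that] that \<open>\<epsilon> > 0\<close> by (simp add: I_iff)
  have Z0: "Z u v (0, x) = 0" if "x \<in> chart_range c" for x u v
  proof -
    \<comment> \<open>With factor 0 the form on the right is only a smooth reference, and \<omega>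
      will do.\<close>
    have "ext_deriv (\<eta> 0) c x u v = 0 * ext_deriv \<omega> c x u v"
      by (rule ext_deriv_scaled[of "chart_range c" x \<omega> c "\<eta> 0" 0, OF open_chart_range[OF c] that])
        (simp_all add: \<eta>0 one_form_smooth[OF \<omega> c])
    then show ?thesis using d\<eta>[of 0 x u v] that \<open>\<epsilon> > 0\<close> by (simp add: I_iff)
  qed
  have prod: "\<exists>C. \<forall>t x. \<bar>t\<bar> \<le> \<epsilon> / 2 \<longrightarrow> x \<in> K \<longrightarrow> \<bar>\<eta> t c x w * ext_deriv (\<eta> t) c x u v\<bar> \<le> C * t\<^sup>2" for u v w
  proof -
    obtain C1 where C1: "\<And>t x. \<bar>t\<bar> \<le> \<epsilon> / 2 \<Longrightarrow> x \<in> K \<Longrightarrow> \<bar>H w (t, x)\<bar> \<le> C1 * \<bar>t\<bar>"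
      using smooth_vanishing_at_0_bound[OF \<open>\<epsilon> > 0\<close> sH[unfolded I_def] H0 K] by blast
    obtain C2 where C2: "\<And>t x. \<bar>t\<bar> \<le> \<epsilon> / 2 \<Longrightarrow> x \<in> K \<Longrightarrow> \<bar>Z u v (t, x)\<bar> \<le> C2 * \<bar>t\<bar>"
      using smooth_vanishing_at_0_bound[OF \<open>\<epsilon> > 0\<close> sZ[unfolded I_def] Z0 K] by blast
    have "\<bar>\<eta> t c x w * ext_deriv (\<eta> t) c x u v\<bar> \<le> (C1 * C2) * t\<^sup>2" if "\<bar>t\<bar> \<le> \<epsilon> / 2" "x \<in> K" for t x
    proof -
      have t: "t \<in> I" and x: "x \<in> chart_range c" using that K \<open>\<epsilon> > 0\<close> by (auto simp: I_iff)
      have "\<bar>\<eta> t c x w * ext_deriv (\<eta> t) c x u v\<bar> = \<bar>H w (t, x)\<bar> * \<bar>Z u v (t, x)\<bar>"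
        by (simp add: \<eta>H d\<eta> t x abs_mult)
      also have "\<dots> \<le> (C1 * \<bar>t\<bar>) * (C2 * \<bar>t\<bar>)"
        by (intro mult_mono' C1 C2 that) auto
      also have "\<dots> = (C1 * C2) * t\<^sup>2" by (simp add: power2_eq_square)
      finally show ?thesis .
    qed
    then show ?thesis by blast
  qed
  obtain Ca where Ca: "\<And>t x. \<bar>t\<bar> \<le> \<epsilon> / 2 \<Longrightarrow> x \<in> K \<Longrightarrow>
      \<bar>\<eta> t c x (axis 1 1) * ext_deriv (\<eta> t) c x (axis 2 1) (axis 3 1)\<bar> \<le> Ca * t\<^sup>2"
    using prod[of "axis 1 1" "axis 2 1" "axis 3 1"] by blast
  obtain Cb where Cb: "\<And>t x. \<bar>t\<bar> \<le> \<epsilon> / 2 \<Longrightarrow> x \<in> K \<Longrightarrow>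
      \<bar>\<eta> t c x (axis 2 1) * ext_deriv (\<eta> t) c x (axis 3 1) (axis 1 1)\<bar> \<le> Cb * t\<^sup>2"
    using prod[of "axis 2 1" "axis 3 1" "axis 1 1"] by blast
  obtain Cc where Cc: "\<And>t x. \<bar>t\<bar> \<le> \<epsilon> / 2 \<Longrightarrow> x \<in> K \<Longrightarrow>
      \<bar>\<eta> t c x (axis 3 1) * ext_deriv (\<eta> t) c x (axis 1 1) (axis 2 1)\<bar> \<le> Cc * t\<^sup>2"
    using prod[of "axis 3 1" "axis 1 1" "axis 2 1"] by blast
  have "\<bar>wedge_density (\<eta> t) c x\<bar> \<le> (Ca + Cb + Cc) * t\<^sup>2" if "\<bar>t\<bar> \<le> \<epsilon> / 2" "x \<in> K" for t x
    using Ca[OF that] Cb[OF that] Cc[OF that]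
    unfolding wedge_density_def wedge12_def distrib_right abs_le_iff by linarith
  then show ?thesis by (rule that[unfolded \<eta>_def[symmetric]])
qed

lemma gv_critical_of_reeb_field:
  assumes \<omega>: "one_form A \<omega>" and R: "reeb_field A \<omega> T"
  shows "gv_critical X A (ker_form \<omega>) T"
  unfolding gv_critical_def
proof (intro allI impI)
  fix \<epsilon> \<omega>t Tt assume var: "variation A (ker_form \<omega>) T \<epsilon> \<omega>t Tt"
  define \<eta> where "\<eta> t = interior_prod (Tt t) (ext_deriv (form_of (ker_form (\<omega>t t)) (Tt t)))" for t
  have "\<epsilon> > 0" using var by (simp add: variation_def)
  obtain F \<rho> where P: "partition_of_unity X A F \<rho>"
    and int: "\<And>\<mu>. integral_form X A \<mu> = (\<Sum>c\<in>F. LINT x:chart_range c|lborel.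
      \<rho> c (chart_inv c x) * \<mu> c x (axis 1 1) (axis 2 1) (axis 3 1))"
    using integral_form_partition by blast
  have gv: "gv X A (ker_form (\<omega>t t)) (Tt t) =
      (\<Sum>c\<in>F. LINT x:chart_range c|lborel. \<rho> c (chart_inv c x) * wedge_density (\<eta> t) c x)" for t
    by (simp add: gv_def int \<eta>_def wedge_density_def Let_def)
  have bound: "\<exists>C. \<forall>t. \<bar>t\<bar> \<le> \<epsilon> / 2 \<longrightarrow>
      \<bar>LINT x:chart_range c|lborel. \<rho> c (chart_inv c x) * wedge_density (\<eta> t) c x\<bar> \<le> C * t\<^sup>2"
    if cF: "c \<in> F" for c
  proof -
    have c: "c \<in> A" using P cF by (auto simp: partition_of_unity_def)
    obtain K where K: "compact K" "K \<subseteq> chart_range c"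
      "\<And>x. x \<in> chart_range c - K \<Longrightarrow> \<rho> c (chart_inv c x) = 0"
      using partition_compact_support[OF P cF] by blast
    obtain C where C: "\<And>t x. \<bar>t\<bar> \<le> \<epsilon> / 2 \<Longrightarrow> x \<in> K \<Longrightarrow> \<bar>wedge_density (\<eta> t) c x\<bar> \<le> C * t\<^sup>2"
      using variation_density_bound[OF R \<omega> var c K(1,2)] unfolding \<eta>_def by blast
    \<comment> \<open>The weights are nonnegative with sum 1, so none exceeds 1.\<close>
    have \<rho>: "\<bar>\<rho> c (chart_inv c x)\<bar> \<le> 1" if "x \<in> K" for x
    proof -
      have p: "chart_inv c x \<in> topspace X"
        using that K(2) chart_inv_in_dom[OF c] chart_dom_subset[OF c] by blast
      have "\<rho> c (chart_inv c x) \<le> (\<Sum>d\<in>F. \<rho> d (chart_inv c x))"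
        using P p cF by (intro member_le_sum) (auto simp: partition_of_unity_def)
      then show ?thesis using P p cF by (simp add: partition_of_unity_def)
    qed
    have "\<bar>LINT x:chart_range c|lborel. \<rho> c (chart_inv c x) * wedge_density (\<eta> t) c x\<bar>
        \<le> (C * t\<^sup>2) * measure lborel K" if t: "\<bar>t\<bar> \<le> \<epsilon> / 2" for t
    proof (rule set_integral_bound_compact_support[OF K(1,2)])
      show "\<rho> c (chart_inv c x) * wedge_density (\<eta> t) c x = 0" if "x \<in> chart_range c - K" for x
        using K(3)[OF that] by simp
      show "\<bar>\<rho> c (chart_inv c x) * wedge_density (\<eta> t) c x\<bar> \<le> C * t\<^sup>2" if "x \<in> K" for x
        using mult_mono[OF \<rho>[OF that] C[OF t that]] by (simp add: abs_mult)
    qed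
    then show ?thesis by (intro exI[of _ "C * measure lborel K"]) (simp add: ac_simps)
  qed
  then have "\<forall>c\<in>F. \<exists>C. \<forall>t. \<bar>t\<bar> \<le> \<epsilon> / 2 \<longrightarrow>
      \<bar>LINT x:chart_range c|lborel. \<rho> c (chart_inv c x) * wedge_density (\<eta> t) c x\<bar> \<le> C * t\<^sup>2"
    by (rule ballI)
  from bchoice[OF this] obtain C where "\<forall>c\<in>F. \<forall>t. \<bar>t\<bar> \<le> \<epsilon> / 2 \<longrightarrow>
      \<bar>LINT x:chart_range c|lborel. \<rho> c (chart_inv c x) * wedge_density (\<eta> t) c x\<bar> \<le> C c * t\<^sup>2" ..
  then have C: "\<bar>LINT x:chart_range c|lborel. \<rho> c (chart_inv c x) * wedge_density (\<eta> t) c x\<bar> \<le> C c * t\<^sup>2"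
    if "c \<in> F" "\<bar>t\<bar> \<le> \<epsilon> / 2" for c t using that by blast
  show "((\<lambda>t. gv X A (ker_form (\<omega>t t)) (Tt t)) has_real_derivative 0) (at 0)"
  proof (rule DERIV_0_of_quadratic_bound)
    show "\<epsilon> / 2 > 0" using \<open>\<epsilon> > 0\<close> by simp
    show "\<bar>gv X A (ker_form (\<omega>t t)) (Tt t)\<bar> \<le> (\<Sum>c\<in>F. C c) * t\<^sup>2" if "\<bar>t\<bar> \<le> \<epsilon> / 2" for t
      unfolding gv sum_distrib_right
      by (rule order_trans[OF sum_abs sum_mono[OF C[OF _ that]]])
  qed
qed

end


section \<open>Contact structures are not extremal\<close>

context closed_manifold
begin

text \<open>Since \<omega>(V) = 0, the normalisation \<omega>(T + t V) = 1 holds with \<omega>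
  unchanged. The family makes sense for every t, so the radius 1 is an arbitrary choice.\<close>

lemma variation_along_vector_field:
  assumes \<omega>: "one_form A \<omega>" and R: "reeb_field A \<omega> T" and V: "vector_field A V"
    and \<omega>V: "\<And>c x. c \<in> A \<Longrightarrow> x \<in> chart_range c \<Longrightarrow> \<omega> c x (V c x) = 0"
  shows "variation A (ker_form \<omega>) T 1 (\<lambda>_. \<omega>) (\<lambda>t c x. T c x + t *\<^sub>R V c x)"
  unfolding variation_def
proof (intro conjI allI impI ballI)
  have T: "vector_field A T" using R by (simp add: reeb_field_def)
  have \<omega>T: "\<omega> c x (T c x) = 1" if "c \<in> A" "x \<in> chart_range c" for c x
    using R that by (simp add: reeb_field_def)
  show "one_form A \<omega>" by (rule \<omega>)
  show "vector_field A (\<lambda>c x. T c x + t *\<^sub>R V c x)" for t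
    unfolding vector_field_def
  proof (intro conjI ballI)
    fix c assume c: "c \<in> A"
    show "smooth_on (chart_range c) (\<lambda>x. T c x + t *\<^sub>R V c x)"
      using T V c
      by (intro smooth_on_add smooth_on_scaleR smooth_on_const open_chart_range[OF c])
        (simp_all add: vector_field_def)
    fix d x assume d: "d \<in> A" and x: "x \<in> overlap c d"
    show "T d (transition c d x) + t *\<^sub>R V d (transition c d x) = transition_deriv c d x (T c x + t *\<^sub>R V c x)"
      using T V c d x linear_transition_deriv[OF c d x]
      by (simp add: vector_field_def linear_add linear_scale)
  qed
  fix c assume c: "c \<in> A"
  have op: "open ({-1<..<1::real} \<times> chart_range c)" by (intro open_Times open_chart_range[OF c]) auto
  \<comment> \<open>A function of position alone becomes jointly smooth in time and position by
    composing with the projection.\<close>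
  have pull: "smooth_on ({-1<..<1::real} \<times> chart_range c) (\<lambda>p. g (snd p))"
    if "smooth_on (chart_range c) g" for g :: "real^3 \<Rightarrow> 'z::real_normed_vector"
    by (rule smooth_on_compose[OF op that smooth_on_bounded_linear[OF bounded_linear_snd]]) auto
  show "smooth_on ({-1<..<1::real} \<times> chart_range c) (\<lambda>(t, x). \<omega> c x v)" for v
    using pull[OF one_form_smooth[OF \<omega> c, of v]] by (simp add: case_prod_beta')
  have "smooth_on ({-1<..<1} \<times> chart_range c) (\<lambda>p. T c (snd p) + fst p *\<^sub>R V c (snd p))"
    using T V c
    by (intro smooth_on_add smooth_on_scaleR op pull smooth_on_bounded_linear[OF bounded_linear_fst])
      (simp_all add: vector_field_def)
  then show "smooth_on ({-1<..<1} \<times> chart_range c) (\<lambda>(t, x). T c x + t *\<^sub>R V c x)"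
    by (simp add: case_prod_beta')
  fix x assume x: "x \<in> chart_range c"
  show "\<omega> c x (T c x + t *\<^sub>R V c x) = 1" for t
    using one_form_linear[OF \<omega> c x] \<omega>T[OF c x] \<omega>V[OF c x] by (simp add: linear_add linear_scale)
  show "\<omega> c x = form_of (ker_form \<omega>) T c x"
    using form_of_ker_form_on_chart[OF \<omega> c x, where T = T] \<omega>T[OF c x] by simp
qed auto

text \<open>An exact identity rather than an expansion in \<open>t\<close>: T contributes nothing to
  the contraction with d\<omega>, and what remains is linear in \<open>t\<close>.\<close>

lemma gv_along_vector_field:
  assumes \<omega>: "one_form A \<omega>" and R: "reeb_field A \<omega> T" and V: "vector_field A V"
    and \<omega>V: "\<And>c x. c \<in> A \<Longrightarrow> x \<in> chart_range c \<Longrightarrow> \<omega> c x (V c x) = 0"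
  defines "\<beta> \<equiv> interior_prod V (ext_deriv \<omega>)"
  shows "gv X A (ker_form \<omega>) (\<lambda>c x. T c x + t *\<^sub>R V c x) = t\<^sup>2 * integral_form X A (wedge12 \<beta> (ext_deriv \<beta>))"
proof -
  let ?T = "\<lambda>c x. T c x + t *\<^sub>R V c x"
  define \<eta> where "\<eta> = interior_prod ?T (ext_deriv (form_of (ker_form \<omega>) ?T))"
  have \<beta>: "one_form A \<beta>" unfolding \<beta>_def by (rule one_form_interior_prod[OF \<omega> V])
  obtain F \<rho> where P: "partition_of_unity X A F \<rho>"
    and int: "\<And>\<mu>. integral_form X A \<mu> = (\<Sum>c\<in>F. LINT x:chart_range c|lborel.
      \<rho> c (chart_inv c x) * \<mu> c x (axis 1 1) (axis 2 1) (axis 3 1))"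
    using integral_form_partition by blast
  have dens: "wedge_density \<eta> c x = t\<^sup>2 * wedge_density \<beta> c x" if cF: "c \<in> F" and x: "x \<in> chart_range c" for c x
  proof -
    have c: "c \<in> A" using P cF by (auto simp: partition_of_unity_def)
    have "\<eta> c y v = t * \<beta> c y v" if y: "y \<in> chart_range c" for y v
    proof -
      have "\<omega> c z (?T c z) = 1" if "z \<in> chart_range c" for z
        using one_form_linear[OF \<omega> c that] \<omega>V[OF c that] R c that
        by (simp add: linear_add linear_scale reeb_field_def)
      then have "\<eta> c y v = ext_deriv \<omega> c y (?T c y) v"
        using ext_deriv_form_of_ker_form[OF \<omega> c y, where T = ?T] by (simp add: \<eta>_def interior_prod_def)
      also have "\<dots> = ext_deriv \<omega> c y (T c y) v + t * ext_deriv \<omega> c y (V c y) v"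
        using linear_add[OF linear_ext_deriv[OF \<omega> c y, of v], of "T c y" "t *\<^sub>R V c y"]
          linear_scale[OF linear_ext_deriv[OF \<omega> c y, of v], of t "V c y"] by simp
      also have "ext_deriv \<omega> c y (T c y) v = 0"
        using R c y by (simp add: reeb_field_def interior_prod_def)
      finally show ?thesis by (simp add: \<beta>_def interior_prod_def)
    qed
    then show ?thesis
      by (intro wedge_density_scaled[of "chart_range c" x \<beta> c \<eta> t] open_chart_range[OF c] x one_form_smooth[OF \<beta> c])
  qed
  have "gv X A (ker_form \<omega>) ?T =
      (\<Sum>c\<in>F. LINT x:chart_range c|lborel. \<rho> c (chart_inv c x) * wedge_density \<eta> c x)"
    by (simp add: gv_def int \<eta>_def wedge_density_def Let_def)
  also have "\<dots> = (\<Sum>c\<in>F. t\<^sup>2 * (LINT x:chart_range c|lborel. \<rho> c (chart_inv c x) * wedge_density \<beta> c x))"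
  proof (rule sum.cong[OF refl])
    fix c assume c: "c \<in> F"
    have "(\<lambda>x. indicator (chart_range c) x *\<^sub>R (\<rho> c (chart_inv c x) * wedge_density \<eta> c x)) =
        (\<lambda>x. t\<^sup>2 * (indicator (chart_range c) x *\<^sub>R (\<rho> c (chart_inv c x) * wedge_density \<beta> c x)))"
      using dens[OF c] by (simp add: indicator_def fun_eq_iff)
    then show "(LINT x:chart_range c|lborel. \<rho> c (chart_inv c x) * wedge_density \<eta> c x) =
        t\<^sup>2 * (LINT x:chart_range c|lborel. \<rho> c (chart_inv c x) * wedge_density \<beta> c x)"
      by (simp only: set_lebesgue_integral_def integral_mult_right_zero)
  qed
  also have "\<dots> = t\<^sup>2 * integral_form X A (wedge12 \<beta> (ext_deriv \<beta>))"
    by (simp add: int wedge_density_def sum_distrib_left)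
  finally show ?thesis .
qed

text \<open>The factor \<open>s\<close> treats both signs at once. All summands are nonnegative, so
  one positive summand decides; it comes from a chart whose weight is positive at the point
  represented by \<open>y\<close>.\<close>

lemma integral_form_sign:
  assumes \<beta>: "one_form A \<beta>"
    and nonneg: "\<And>c x. c \<in> A \<Longrightarrow> x \<in> chart_range c \<Longrightarrow> 0 \<le> s * wedge_density \<beta> c x"
    and d: "d \<in> A" and y: "y \<in> chart_range d" and pos: "0 < s * wedge_density \<beta> d y"
  shows "0 < s * integral_form X A (wedge12 \<beta> (ext_deriv \<beta>))"
proof -
  obtain F \<rho> where P: "partition_of_unity X A F \<rho>"
    and int: "\<And>\<mu>. integral_form X A \<mu> = (\<Sum>c\<in>F. LINT x:chart_range c|lborel.
      \<rho> c (chart_inv c x) * \<mu> c x (axis 1 1) (axis 2 1) (axis 3 1))"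
    using integral_form_partition by blast
  have FA: "finite F" "F \<subseteq> A" using P by (simp_all add: partition_of_unity_def)
  let ?f = "\<lambda>c x. \<rho> c (chart_inv c x) * (s * wedge_density \<beta> c x)"
  have f_nonneg: "0 \<le> ?f c x" if "c \<in> F" "x \<in> chart_range c" for c x
  proof -
    have "chart_inv c x \<in> topspace X"
      using that FA chart_inv_in_dom chart_dom_subset by blast
    then have "0 \<le> \<rho> c (chart_inv c x)" using P that(1) by (simp add: partition_of_unity_def)
    moreover have "0 \<le> s * wedge_density \<beta> c x" by (rule nonneg) (use that FA in auto)
    ultimately show ?thesis by (rule mult_nonneg_nonneg)
  qed
  have cont: "continuous_on (chart_range c) (?f c)" if "c \<in> F" for c
    using P that FA smooth_function_imp_continuous_on[of "\<rho> c" c] wedge_density_continuous_on[OF \<beta>, of c]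
    by (auto intro!: continuous_intros simp: partition_of_unity_def)
  have integrable: "set_integrable lborel (chart_range c) (?f c)" if cF: "c \<in> F" for c
  proof -
    obtain K where K: "compact K" "K \<subseteq> chart_range c"
      "\<And>x. x \<in> chart_range c - K \<Longrightarrow> \<rho> c (chart_inv c x) = 0"
      using partition_compact_support[OF P cF] by blast
    show ?thesis
      using cF FA K(3) by (intro set_integrable_compact_support[OF _ cont[OF cF] K(1,2)] open_chart_range) auto
  qed
  let ?q = "chart_inv d y"
  have q: "?q \<in> topspace X" "?q \<in> chart_dom d" using chart_inv_in_dom[OF d y] chart_dom_subset[OF d] by auto
  have "\<exists>c\<in>F. \<rho> c ?q \<noteq> 0"
  proof (rule ccontr)
    assume "\<not> (\<exists>c\<in>F. \<rho> c ?q \<noteq> 0)"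
    then have "(\<Sum>c\<in>F. \<rho> c ?q) = 0" by (intro sum.neutral) blast
    then show False using P q by (simp add: partition_of_unity_def)
  qed
  then obtain c where cF: "c \<in> F" and \<rho>c: "\<rho> c ?q \<noteq> 0" by blast
  have c: "c \<in> A" using cF FA by blast
  have \<rho>pos: "0 < \<rho> c ?q"
  proof -
    have "0 \<le> \<rho> c ?q" using P cF q by (simp add: partition_of_unity_def)
    then show ?thesis using \<rho>c by simp
  qed
  have qc: "?q \<in> chart_dom c"
  proof -
    have "?q \<in> X closure_of {p \<in> topspace X. \<rho> c p \<noteq> 0}"
      using closure_of_subset[of "{p \<in> topspace X. \<rho> c p \<noteq> 0}" X] q \<rho>c by auto
    moreover have "X closure_of {p \<in> topspace X. \<rho> c p \<noteq> 0} \<subseteq> chart_dom c"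
      using P cF by (simp add: partition_of_unity_def)
    ultimately show ?thesis by blast
  qed
  have yc: "y \<in> overlap d c" using y qc by (simp add: overlap_iff[OF d])
  let ?z = "transition d c y"
  have z: "?z \<in> chart_range c" "chart_inv c ?z = ?q"
    using transition_in_overlap[OF d c yc] overlap_iff[OF c] chart_inv_transition[OF d c yc] by auto
  \<comment> \<open>Positivity is assumed in chart \<open>d\<close>, but the summand lives in chart
    \<open>c\<close>; the positive Jacobian carries it over.\<close>
  have "s * wedge_density \<beta> d y = det (matrix (transition_deriv d c y)) * (s * wedge_density \<beta> c ?z)"
    using wedge_density_transition[OF \<beta> d c yc] by simp
  with pos have "0 < det (matrix (transition_deriv d c y)) * (s * wedge_density \<beta> c ?z)" by (simp only:)
  then have "0 < s * wedge_density \<beta> c ?z"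
    by (rule zero_less_mult_pos) (rule transition_det_pos[OF d c yc])
  then have fz: "0 < ?f c ?z" using \<rho>pos z by simp
  have "0 < (\<Sum>c\<in>F. LINT x:chart_range c|lborel. ?f c x)"
  proof (rule sum_pos2[OF FA(1) cF])
    show "0 < (LINT x:chart_range c|lborel. ?f c x)"
      by (rule set_integral_pos[OF open_chart_range[OF c] cont[OF cF] integrable[OF cF] f_nonneg[OF cF] z(1) fz])
    show "0 \<le> (LINT x:chart_range c|lborel. ?f c x)" if "c \<in> F" for c
      unfolding set_lebesgue_integral_def
      using f_nonneg[OF that] by (intro Bochner_Integration.integral_nonneg) (simp add: indicator_def)
  qed
  also have "\<dots> = s * integral_form X A (wedge12 \<beta> (ext_deriv \<beta>))"
  proof -
    have "(LINT x:chart_range c|lborel. ?f c x) =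
        s * (LINT x:chart_range c|lborel. \<rho> c (chart_inv c x) * wedge_density \<beta> c x)" for c
      by (simp only: mult.left_commute[of _ s] set_integral_mult_right)
    then show ?thesis by (simp add: int wedge_density_def sum_distrib_left)
  qed
  finally show ?thesis .
qed

text \<open>Push-forward of a field given in chart \<open>c\<close>. The value 0 off the overlap is
  the extension by zero, appropriate when \<open>V\<close> has compact support in the chart.\<close>

definition extend_field :: "'a chart \<Rightarrow> (real^3 \<Rightarrow> real^3) \<Rightarrow> 'a vec_field" where
  "extend_field c V d y =
    (if y \<in> overlap d c then transition_deriv c d (transition d c y) (V (transition d c y)) else 0)"

context
  fixes c and V :: "real^3 \<Rightarrow> real^3" and C
  assumes c: "c \<in> A" and V: "smooth_on (chart_range c) V"
    and C: "compact C" "C \<subseteq> chart_range c" "\<And>x. x \<in> chart_range c \<Longrightarrow> x \<notin> C \<Longrightarrow> V x = 0"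
begin

lemma extend_field_self:
  assumes "x \<in> chart_range c"
  shows "extend_field c V c x = V x"
  using assms c by (simp add: extend_field_def overlap_self transition_self transition_deriv_self)

text \<open>Smoothness is extension by zero off the points represented by \<open>C\<close>; the
  transformation law is the chain rule for transition maps.\<close>

lemma vector_field_extend_field: "vector_field A (extend_field c V)"
  unfolding vector_field_def
proof (intro conjI ballI)
  fix d assume d: "d \<in> A"
  let ?\<tau> = "transition d c"
  have \<tau>: "?\<tau> ` overlap d c \<subseteq> overlap c d" using transition_in_overlap[OF d c] by blast
  have \<tau>c: "overlap c d \<subseteq> chart_range c" using overlap_iff[OF c] by blast
  have op: "open (overlap d c)" by (rule open_overlap[OF d c])
  show "smooth_on (chart_range d) (extend_field c V d)"
  proof (rule smooth_on_extend_zero[OF c d closedin_chart_inv_image[OF c C(1,2)]])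
    show "chart_inv c ` C \<subseteq> chart_dom c" using C(2) chart_inv_in_dom[OF c] by blast
    have "smooth_on (overlap d c) (\<lambda>y. transition_deriv c d (?\<tau> y) (V (?\<tau> y)))"
    proof (rule smooth_on_linear_fields[OF op, where a = "\<lambda>y. transition_deriv c d (?\<tau> y)"])
      show "linear (transition_deriv c d (?\<tau> y))" if "y \<in> overlap d c" for y
        using linear_transition_deriv[OF c d] \<tau> that by blast
      show "smooth_on (overlap d c) (\<lambda>y. transition_deriv c d (?\<tau> y) v)" for v
        by (rule smooth_on_compose[OF op smooth_on_frechet_derivative[OF transition_smooth[OF c d]]
              transition_smooth[OF d c] \<tau>])
      show "smooth_on (overlap d c) (\<lambda>y. V (?\<tau> y))"
        by (rule smooth_on_compose[OF op V transition_smooth[OF d c] order_trans[OF \<tau> \<tau>c]])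
    qed
    then show "smooth_on (overlap d c) (extend_field c V d)"
      using smooth_on_cong[OF op, of "extend_field c V d"] by (simp add: extend_field_def)
    fix y assume y: "y \<in> chart_range d" and yC: "chart_inv d y \<notin> chart_inv c ` C"
    show "extend_field c V d y = 0"
    proof (cases "y \<in> overlap d c")
      case True
      then have \<tau>y: "?\<tau> y \<in> overlap c d" using \<tau> by blast
      have "?\<tau> y \<notin> C" using yC chart_inv_transition[OF d c True] by (auto simp: image_iff)
      then have "V (?\<tau> y) = 0" using C(3) \<tau>y \<tau>c by blast
      then show ?thesis using linear_0[OF linear_transition_deriv[OF c d \<tau>y]] by (simp add: extend_field_def)
    qed (simp add: extend_field_def)
  qed
  fix e y assume e: "e \<in> A" and y: "y \<in> overlap d e"
  have inv: "chart_inv e (transition d e y) = chart_inv d y" by (rule chart_inv_transition[OF d e y])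
  have ye: "transition d e y \<in> chart_range e" and yd: "y \<in> chart_range d"
    using transition_in_overlap[OF d e y] overlap_iff[OF e] overlap_iff[OF d] y by blast+
  show "extend_field c V e (transition d e y) = transition_deriv d e y (extend_field c V d y)"
  proof (cases "y \<in> overlap d c")
    case True
    let ?x = "?\<tau> y"
    have e': "transition d e y \<in> overlap e c" using True ye inv by (simp add: overlap_iff d e)
    have x1: "?x \<in> overlap c d" by (rule transition_in_overlap[OF d c True])
    have x2: "?x \<in> overlap c e"
      using x1 y chart_inv_transition[OF d c True] by (simp add: overlap_iff c d)
    have "transition e c (transition d e y) = ?x" by (rule transition_transition[OF d e y])
    moreover have "transition c d ?x = y"
      using transition_transition[OF d c True, of d] transition_self[OF d yd] by simp
    ultimately show ?thesis
      using transition_deriv_compose[OF c d e x1 x2] e' True by (simp add: extend_field_def)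
  next
    case False
    \<comment> \<open>Whether a point lies in the domain of \<open>c\<close> does not depend on the
      chart it is viewed in, so both sides are 0.\<close>
    then have "transition d e y \<notin> overlap e c" using yd inv by (simp add: overlap_iff d e)
    then show ?thesis
      using False linear_0[OF linear_transition_deriv[OF d e y]] by (simp add: extend_field_def)
  qed
qed

end

end

section \<open>The density of an oscillating 1-form\<close>

lemma oscillating_form_derivative:
  fixes h :: "real^3 \<Rightarrow> real"
  assumes S: "open S" "x \<in> S" and \<phi>: "\<phi> differentiable (at x)" and h: "linear h"
    and \<alpha>: "smooth_on S (\<lambda>y. \<alpha>\<^sub>1 c y w)" "smooth_on S (\<lambda>y. \<alpha>\<^sub>2 c y w)"
    and \<beta>: "\<And>y. y \<in> S \<Longrightarrow> \<beta> c y w = \<phi> y * (cos (k * h y) * \<alpha>\<^sub>1 c y w + sin (k * h y) * \<alpha>\<^sub>2 c y w)"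
  shows "frechet_derivative (\<lambda>y. \<beta> c y w) (at x) a =
    frechet_derivative \<phi> (at x) a * (cos (k * h x) * \<alpha>\<^sub>1 c x w + sin (k * h x) * \<alpha>\<^sub>2 c x w) +
    \<phi> x * (k * h a * (cos (k * h x) * \<alpha>\<^sub>2 c x w - sin (k * h x) * \<alpha>\<^sub>1 c x w) +
      cos (k * h x) * frechet_derivative (\<lambda>y. \<alpha>\<^sub>1 c y w) (at x) a +
      sin (k * h x) * frechet_derivative (\<lambda>y. \<alpha>\<^sub>2 c y w) (at x) a)" (is "_ = ?D a")
proof (rule frechet_derivative_eqI)
  have "((\<lambda>y. k * h y) has_derivative (\<lambda>a. k * h a)) (at x)"
    using h by (intro has_derivative_mult_right bounded_linear_imp_has_derivative)
      (simp add: linear_conv_bounded_linear)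
  note cs = has_derivative_cos[OF this] has_derivative_sin[OF this]
  have "(\<phi> has_derivative frechet_derivative \<phi> (at x)) (at x)"
    using \<phi> frechet_derivative_works by blast
  from has_derivative_mult[OF this has_derivative_add[OF
        has_derivative_mult[OF cs(1) smooth_on_has_derivative[OF \<alpha>(1) S(2)]]
        has_derivative_mult[OF cs(2) smooth_on_has_derivative[OF \<alpha>(2) S(2)]]]]
  have "((\<lambda>y. \<phi> y * (cos (k * h y) * \<alpha>\<^sub>1 c y w + sin (k * h y) * \<alpha>\<^sub>2 c y w)) has_derivative ?D) (at x)"
    by (rule has_derivative_eq_rhs) (auto simp: algebra_simps)
  then show "((\<lambda>y. \<beta> c y w) has_derivative ?D) (at x)"
    by (rule has_derivative_transform_within_open[OF _ S]) (simp add: \<beta>)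
qed

text \<open>The 2-form h \<and> \<alpha>, where \<open>h\<close> has constant coefficients in the
  chart; below, k h is the differential of the phase.\<close>

definition wedge_linear :: "(real^3 \<Rightarrow> real) \<Rightarrow> 'a form1 \<Rightarrow> 'a form2" where
  "wedge_linear h \<alpha> c x u v = h u * \<alpha> c x v - h v * \<alpha> c x u"

text \<open>Write \<beta> = \<phi> \<gamma> with \<gamma> = cos(k h) \<alpha>1 + sin(k h) \<alpha>2,
  and let \<gamma>' = cos(k h) \<alpha>2 - sin(k h) \<alpha>1. The term with d\<phi> contains
  \<gamma> twice and vanishes. The term of order k is \<gamma> \<and> h \<and> \<gamma>', which
  equals (cos^2 + sin^2) \<alpha>1 \<and> h \<and> \<alpha>2 and so does not oscillate. The rest is
  bounded in k.\<close>

lemma wedge_density_oscillating: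
  fixes h :: "real^3 \<Rightarrow> real"
  assumes S: "open S" "x \<in> S" and \<phi>: "\<phi> differentiable (at x)" and h: "linear h"
    and \<alpha>: "\<And>w. smooth_on S (\<lambda>y. \<alpha>\<^sub>1 c y w)" "\<And>w. smooth_on S (\<lambda>y. \<alpha>\<^sub>2 c y w)"
    and \<beta>: "\<And>y w. y \<in> S \<Longrightarrow> \<beta> c y w = \<phi> y * (cos (k * h y) * \<alpha>\<^sub>1 c y w + sin (k * h y) * \<alpha>\<^sub>2 c y w)"
  defines "q \<alpha> \<theta> \<equiv> wedge12 \<alpha> \<theta> c x (axis 1 1) (axis 2 1) (axis 3 1)"
  shows "wedge_density \<beta> c x = (\<phi> x)\<^sup>2 * (k * q \<alpha>\<^sub>1 (wedge_linear h \<alpha>\<^sub>2) +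
    ((cos (k * h x))\<^sup>2 * q \<alpha>\<^sub>1 (ext_deriv \<alpha>\<^sub>1) +
      cos (k * h x) * sin (k * h x) * (q \<alpha>\<^sub>1 (ext_deriv \<alpha>\<^sub>2) + q \<alpha>\<^sub>2 (ext_deriv \<alpha>\<^sub>1)) +
      (sin (k * h x))\<^sup>2 * q \<alpha>\<^sub>2 (ext_deriv \<alpha>\<^sub>2)))"
proof -
  define p where "p = frechet_derivative \<phi> (at x)"
  define C where "C = cos (k * h x)"
  define S' where "S' = sin (k * h x)"
  have CS: "C\<^sup>2 + S'\<^sup>2 = 1" by (simp add: C_def S'_def)
  have \<beta>x: "\<beta> c x w = \<phi> x * (C * \<alpha>\<^sub>1 c x w + S' * \<alpha>\<^sub>2 c x w)" for w
    using \<beta>[OF S(2)] by (simp add: C_def S'_def)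
  have d\<beta>: "ext_deriv \<beta> c x a b =
      p a * (C * \<alpha>\<^sub>1 c x b + S' * \<alpha>\<^sub>2 c x b) - p b * (C * \<alpha>\<^sub>1 c x a + S' * \<alpha>\<^sub>2 c x a) +
      \<phi> x * (k * (h a * (C * \<alpha>\<^sub>2 c x b - S' * \<alpha>\<^sub>1 c x b) - h b * (C * \<alpha>\<^sub>2 c x a - S' * \<alpha>\<^sub>1 c x a)) +
        C * ext_deriv \<alpha>\<^sub>1 c x a b + S' * ext_deriv \<alpha>\<^sub>2 c x a b)" for a b
  proof -
    have D: "frechet_derivative (\<lambda>y. \<beta> c y w) (at x) a = p a * (C * \<alpha>\<^sub>1 c x w + S' * \<alpha>\<^sub>2 c x w) +
      \<phi> x * (k * h a * (C * \<alpha>\<^sub>2 c x w - S' * \<alpha>\<^sub>1 c x w) +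
        C * frechet_derivative (\<lambda>y. \<alpha>\<^sub>1 c y w) (at x) a +
        S' * frechet_derivative (\<lambda>y. \<alpha>\<^sub>2 c y w) (at x) a)" for w a
      unfolding p_def C_def S'_def
      by (rule oscillating_form_derivative[where \<beta> = \<beta> and c = c and \<alpha>\<^sub>1 = \<alpha>\<^sub>1 and \<alpha>\<^sub>2 = \<alpha>\<^sub>2, OF S \<phi> h])
        (rule \<alpha> \<beta>, assumption?)+
    show ?thesis unfolding ext_deriv_def D by (simp add: algebra_simps)
  qed
  \<comment> \<open>A ring identity in which \<open>C\<^sup>2 + S'\<^sup>2\<close> is left standing;
    the trigonometric relation enters only afterwards, through \<open>CS\<close>.\<close>
  have alg: "f * (C * a1 + S' * b1) * (p2 * (C * a3 + S' * b3) - p3 * (C * a2 + S' * b2) +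
        f * (k * (h2 * (C * b3 - S' * a3) - h3 * (C * b2 - S' * a2)) + C * A23 + S' * B23)) +
      f * (C * a2 + S' * b2) * (p3 * (C * a1 + S' * b1) - p1 * (C * a3 + S' * b3) +
        f * (k * (h3 * (C * b1 - S' * a1) - h1 * (C * b3 - S' * a3)) + C * A31 + S' * B31)) +
      f * (C * a3 + S' * b3) * (p1 * (C * a2 + S' * b2) - p2 * (C * a1 + S' * b1) +
        f * (k * (h1 * (C * b2 - S' * a2) - h2 * (C * b1 - S' * a1)) + C * A12 + S' * B12)) =
      f\<^sup>2 * (k * ((C\<^sup>2 + S'\<^sup>2) * (a1 * (h2 * b3 - h3 * b2) + a2 * (h3 * b1 - h1 * b3) + a3 * (h1 * b2 - h2 * b1))) +
        (C\<^sup>2 * (a1 * A23 + a2 * A31 + a3 * A12) +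
          C * S' * ((a1 * B23 + a2 * B31 + a3 * B12) + (b1 * A23 + b2 * A31 + b3 * A12)) +
          S'\<^sup>2 * (b1 * B23 + b2 * B31 + b3 * B12)))"
    for f a1 a2 a3 b1 b2 b3 p1 p2 p3 h1 h2 h3 A12 A23 A31 B12 B23 B31 :: real
    by (simp add: algebra_simps power2_eq_square)
  show ?thesis
    unfolding wedge_density_def q_def wedge12_def wedge_linear_def \<beta>x d\<beta> C_def[symmetric] S'_def[symmetric]
      alg CS by simp
qed


lemma abs_mult_le_of_abs_le_1: "\<bar>a * b\<bar> \<le> \<bar>b\<bar>" if "\<bar>a\<bar> \<le> 1" for a b :: real
  using that by (simp add: abs_mult mult_left_le_one_le)

text \<open>The bound does not depend on \<open>y\<close>, where the frequency sits, so the
  remainder stays bounded as the frequency grows.\<close>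

lemma abs_trigonometric_form_le:
  fixes a b c d :: real
  shows "\<bar>(cos y)\<^sup>2 * a + cos y * sin y * (b + c) + (sin y)\<^sup>2 * d\<bar> \<le> \<bar>a\<bar> + \<bar>b\<bar> + \<bar>c\<bar> + \<bar>d\<bar>"
proof -
  have "\<bar>(cos y)\<^sup>2\<bar> \<le> 1" "\<bar>(sin y)\<^sup>2\<bar> \<le> 1" by (simp_all add: abs_square_le_1)
  moreover have "\<bar>cos y * sin y\<bar> \<le> 1"
    using abs_mult_le_of_abs_le_1[of "cos y" "sin y"] abs_sin_le_one[of y] abs_cos_le_one[of y] by linarith
  ultimately have "\<bar>(cos y)\<^sup>2 * a\<bar> \<le> \<bar>a\<bar>" "\<bar>cos y * sin y * (b + c)\<bar> \<le> \<bar>b + c\<bar>" "\<bar>(sin y)\<^sup>2 * d\<bar> \<le> \<bar>d\<bar>"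
    by (simp_all only: abs_mult_le_of_abs_le_1)
  then show ?thesis by linarith
qed

section \<open>Choice of the perturbing field\<close>

context closed_manifold
begin

text \<open>Evaluate on the triple T, u, v. Both 1-forms kill T, each kills its own vector, and
  \<omega>(T) = 1, so only - (d\<omega>(u, v))^2 remains. A 3-form that is nonzero on one triple is
  nonzero on the coordinate vectors.\<close>

lemma wedge_linear_contact_nonzero:
  assumes \<omega>: "one_form A \<omega>" and R: "reeb_field A \<omega> T" and c: "c \<in> A" and p: "p \<in> chart_range c"
    and uv: "ext_deriv \<omega> c p u v \<noteq> 0"
  defines "\<alpha> w \<equiv> interior_prod (\<lambda>_ _. w) (ext_deriv \<omega>)"
  shows "wedge12 (\<alpha> u) (wedge_linear (\<omega> c p) (\<alpha> v)) c p (axis 1 1) (axis 2 1) (axis 3 1) \<noteq> 0"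
proof -
  let ?h = "\<omega> c p" and ?b = "wedge_linear (\<omega> c p) (\<alpha> v)"
  have \<alpha>: "linear (\<alpha> w c p)" for w
  proof -
    have "\<alpha> w c p = ext_deriv \<omega> c p w" by (rule ext) (simp add: \<alpha>_def interior_prod_def)
    then show ?thesis using linear_ext_deriv_right[OF \<omega> c p] by simp
  qed
  have h: "linear ?h" by (rule one_form_linear[OF \<omega> c p])
  have \<alpha>T: "\<alpha> w c p (T c p) = 0" for w
    using R c p ext_deriv_antisym[of \<omega> c p w "T c p"]
    by (simp add: \<alpha>_def reeb_field_def interior_prod_def)
  have diag: "\<alpha> w c p w = 0" for w
    using ext_deriv_antisym[of \<omega> c p w w] by (simp add: \<alpha>_def interior_prod_def)
  have hT: "?h (T c p) = 1" using R c p by (simp add: reeb_field_def)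
  have "wedge12 (\<alpha> u) ?b c p (T c p) u v = \<alpha> u c p v * \<alpha> v c p u"
    by (simp add: wedge12_def wedge_linear_def \<alpha>T diag hT)
  also have "\<dots> = - (ext_deriv \<omega> c p u v)\<^sup>2"
    using ext_deriv_antisym[of \<omega> c p v u]
    by (simp add: \<alpha>_def interior_prod_def power2_eq_square)
  finally have "wedge12 (\<alpha> u) ?b c p (T c p) u v \<noteq> 0" using uv by simp
  moreover have "wedge12 (\<alpha> u) ?b c p (T c p) u v = trilinear_det (T c p) u v *
      wedge12 (\<alpha> u) ?b c p (axis 1 1) (axis 2 1) (axis 3 1)"
  proof (rule wedge12_eq_det[of "\<alpha> u" c p ?b])
    show "linear (\<alpha> u c p)" by (rule \<alpha>)
    show "linear (\<lambda>a. ?b c p a b)" for b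
      unfolding wedge_linear_def
      by (rule linearI) (simp_all add: linear_add[OF \<alpha>] linear_add[OF h] linear_scale[OF \<alpha>] linear_scale[OF h] algebra_simps)
    show "?b c p b a = - ?b c p a b" for a b by (simp add: wedge_linear_def)
  qed
  ultimately show ?thesis by (metis mult_zero_right)
qed

text \<open>Writing \<open>\<alpha>\<^sub>w\<close> for \<open>\<iota>\<^sub>w d\<omega>\<close> and \<open>h\<close> for the linear extension of \<open>\<omega>\<^sub>p\<close>, the field
  \<open>\<phi> (cos (k h) u + sin (k h) v)\<close>, projected to \<open>ker \<omega>\<close> along \<open>T\<close>, gives
  \<open>\<beta> \<and> d\<beta> = \<phi>\<^sup>2 (k \<alpha>\<^sub>u \<and> h \<and> \<alpha>\<^sub>v + O(1))\<close>. Hence a large \<open>\<bar>k\<bar>\<close> makes the sign of \<open>\<beta> \<and> d\<beta>\<close> constant,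
  and equal to any prescribed one.\<close>

lemma transverse_field_with_sign:
  assumes contact: "contact_form A \<omega>" and R: "reeb_field A \<omega> T" and "topspace X \<noteq> {}"
    and s: "\<bar>s\<bar> = (1::real)"
  obtains V where "vector_field A V"
    "\<And>c x. c \<in> A \<Longrightarrow> x \<in> chart_range c \<Longrightarrow> \<omega> c x (V c x) = 0"
    "0 < s * integral_form X A (wedge12 (interior_prod V (ext_deriv \<omega>)) (ext_deriv (interior_prod V (ext_deriv \<omega>))))"
proof -
  have \<omega>: "one_form A \<omega>" using contact by (simp add: contact_form_def)
  have T: "vector_field A T" using R by (simp add: reeb_field_def)
  obtain c p where c: "c \<in> A" and p: "p \<in> chart_range c"
    using \<open>topspace X \<noteq> {}\<close> chart_cover chart_map_in_range by blast
  note op = open_chart_range[OF c]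
  \<comment> \<open>Constant coordinate vectors; nonvanishing of \<omega> \<and> d\<omega> at
    \<open>p\<close> forces d\<omega> \<noteq> 0 there.\<close>
  obtain u v where uv: "ext_deriv \<omega> c p u v \<noteq> 0"
  proof -
    obtain a b d where "wedge12 \<omega> (ext_deriv \<omega>) c p a b d \<noteq> 0"
      using contact c p unfolding contact_form_def by blast
    then have "ext_deriv \<omega> c p b d \<noteq> 0 \<or> ext_deriv \<omega> c p d a \<noteq> 0 \<or> ext_deriv \<omega> c p a b \<noteq> 0"
      by (auto simp: wedge12_def)
    then show ?thesis using that by blast
  qed
  define \<alpha> where "\<alpha> w = interior_prod (\<lambda>_ _. w) (ext_deriv \<omega>)" for w
  define h where "h = \<omega> c p"
  define e where "e \<mu> = \<mu> (axis 1 1) (axis 2 1) (axis (3::3) (1::real))" for \<mu> :: "real^3 \<Rightarrow> real^3 \<Rightarrow> real^3 \<Rightarrow> real"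
  \<comment> \<open>\<open>D\<close> is the coefficient of the term of order \<open>k\<close>; the
    \<open>Q\<close> are those of the terms that stay bounded in \<open>k\<close>.\<close>
  define D where "D x = e (wedge12 (\<alpha> u) (wedge_linear h (\<alpha> v)) c x)" for x
  define Q where "Q a b x = e (wedge12 (\<alpha> a) (ext_deriv (\<alpha> b)) c x)" for a b x
  have h: "linear h" unfolding h_def by (rule one_form_linear[OF \<omega> c p])
  then have bh: "bounded_linear h" by (simp add: linear_conv_bounded_linear)
  have s\<alpha>: "smooth_on (chart_range c) (\<lambda>x. \<alpha> w c x a)" for w a
    using smooth_on_ext_deriv[OF \<omega> c, of w a] by (simp add: \<alpha>_def interior_prod_def)
  have "smooth_on (chart_range c) D"
    unfolding D_def e_def wedge12_def wedge_linear_def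
    by (intro smooth_on_add smooth_on_mult smooth_on_diff s\<alpha> op smooth_on_const)
  then have "isCont D p" using smooth_on_imp_continuous_on continuous_on_eq_continuous_at[OF op] p by blast
  have "smooth_on (chart_range c) (Q a b)" for a b
    unfolding Q_def e_def wedge12_def ext_deriv_def
    by (intro smooth_on_add smooth_on_mult smooth_on_diff s\<alpha> op smooth_on_frechet_derivative)
  then have cQ: "continuous_on (chart_range c) (Q a b)" for a b using smooth_on_imp_continuous_on by blast
  have Dp: "D p \<noteq> 0"
    using wedge_linear_contact_nonzero[OF \<omega> R c p uv] by (simp add: D_def e_def \<alpha>_def h_def)
  obtain r1 where r1: "r1 > 0" "\<And>x. dist x p < r1 \<Longrightarrow> \<bar>D x - D p\<bar> < \<bar>D p\<bar> / 2"
  proof -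
    have "0 < \<bar>D p\<bar> / 2" using Dp by simp
    then have "\<exists>d>0. \<forall>x. dist x p < d \<longrightarrow> dist (D x) (D p) < \<bar>D p\<bar> / 2"
      using \<open>isCont D p\<close> unfolding continuous_at_eps_delta by blast
    then show ?thesis using that unfolding dist_real_def by blast
  qed
  obtain r2 where r2: "r2 > 0" "cball p r2 \<subseteq> chart_range c" using op p open_contains_cball by blast
  \<comment> \<open>One radius for three purposes: the support of the cut-off, the compact set that
    bounds the remainder, and the open ball on which \<open>D\<close> keeps its sign and at least
    half its size at \<open>p\<close>.\<close>
  define r where "r = min r1 r2"
  have r: "r > 0" "cball p r \<subseteq> chart_range c" using r1 r2 by (auto simp: r_def)
  define N where "N x = \<bar>Q u u x\<bar> + \<bar>Q u v x\<bar> + \<bar>Q v u x\<bar> + \<bar>Q v v x\<bar>" for x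
  have "continuous_on (cball p r) N"
    unfolding N_def by (intro continuous_intros continuous_on_subset[OF cQ r(2)])
  then have "bounded (N ` cball p r)"
    by (intro compact_imp_bounded compact_continuous_image) auto
  then obtain M where "\<forall>x\<in>N ` cball p r. norm x \<le> M" unfolding bounded_iff ..
  then have M: "\<bar>N x\<bar> \<le> M" if "x \<in> cball p r" for x using that by simp
  \<comment> \<open>On the ball \<open>D\<close> has the sign of \<open>D p\<close> and at least
    half its size, so \<open>s * (k * D x)\<close> is at least \<open>M + 1\<close>, while the
    remainder is at most \<open>M\<close>; the extra 1 makes the sum strictly positive.\<close>
  define k where "k = s * sgn (D p) * (2 * (M + 1) / \<bar>D p\<bar>)"
  have "0 \<le> M" using M[of p] r by simp
  have sgn: "s * s = 1" using s by (metis abs_mult_self_eq mult_1)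
  define \<phi> where "\<phi> = bump p r"
  define W where "W x = cos (k * h x) *\<^sub>R u + sin (k * h x) *\<^sub>R v" for x
  \<comment> \<open>Subtracting the T-component puts the field into ker \<omega> without changing
    its contraction with d\<omega>, as T lies in the kernel of d\<omega>.\<close>
  define V0 where "V0 x = \<phi> x *\<^sub>R (W x - \<omega> c x (W x) *\<^sub>R T c x)" for x
  have s\<phi>: "smooth_on S \<phi>" for S unfolding \<phi>_def by (rule smooth_on_subset[OF smooth_on_bump]) auto
  have skh: "smooth_on (chart_range c) (\<lambda>x. k * h x)"
    by (intro smooth_on_mult op smooth_on_const smooth_on_bounded_linear bh)
  have sW: "smooth_on (chart_range c) W"
    unfolding W_def
    by (intro smooth_on_add smooth_on_scaleR op smooth_on_const
        smooth_on_compose[OF op smooth_on_sin_cos(1) skh] smooth_on_compose[OF op smooth_on_sin_cos(2) skh]) auto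
  have s\<omega>W: "smooth_on (chart_range c) (\<lambda>x. \<omega> c x (W x))"
    by (rule smooth_on_linear_fields[OF op one_form_linear[OF \<omega> c] one_form_smooth[OF \<omega> c] sW])
  have sT: "smooth_on (chart_range c) (T c)" using T c by (simp add: vector_field_def)
  have sV0: "smooth_on (chart_range c) V0"
    unfolding V0_def
    by (rule smooth_on_scaleR[OF op s\<phi> smooth_on_diff[OF op sW smooth_on_scaleR[OF op s\<omega>W sT]]])
  have \<phi>0: "\<phi> x = 0" if "x \<notin> cball p r" for x
    using that r by (auto simp: \<phi>_def bump_eq_0_iff)
  then have V00: "V0 x = 0" if "x \<notin> cball p r" for x using that by (simp add: V0_def)
  define V where "V = extend_field c V0"
  define \<beta> where "\<beta> = interior_prod V (ext_deriv \<omega>)"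
  have V: "vector_field A V"
    unfolding V_def by (rule vector_field_extend_field[OF c sV0 compact_cball r(2)]) (rule V00)
  have VV0: "V c x = V0 x" if "x \<in> chart_range c" for x
    unfolding V_def by (rule extend_field_self[OF c sV0 compact_cball r(2) _ that]) (rule V00)
  have \<beta>1: "one_form A \<beta>" unfolding \<beta>_def by (rule one_form_interior_prod[OF \<omega> V])
  have \<omega>V0: "\<omega> c x (V0 x) = 0" if x: "x \<in> chart_range c" for x
    using R c x one_form_linear[OF \<omega> c x]
    by (simp add: V0_def linear_scale linear_diff reeb_field_def)
  have \<omega>V: "\<omega> d y (V d y) = 0" if d: "d \<in> A" and y: "y \<in> chart_range d" for d y
  proof (cases "y \<in> overlap d c")
    case True
    have "\<omega> d y (V d y) = \<omega> c (transition d c y) (transition_deriv d c y (V d y))"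
      using \<omega> d c True by (simp add: one_form_def)
    also have "transition_deriv d c y (V d y) = V c (transition d c y)"
      using V d c True by (simp add: vector_field_def)
    finally show ?thesis
      using VV0 \<omega>V0 transition_in_overlap[OF d c True] by (simp add: overlap_iff[OF c])
  next
    case False
    then show ?thesis
      using linear_0[OF one_form_linear[OF \<omega> d y]] by (simp add: V_def extend_field_def)
  qed
  have \<beta>: "\<beta> c x w = \<phi> x * (cos (k * h x) * \<alpha> u c x w + sin (k * h x) * \<alpha> v c x w)"
    if x: "x \<in> chart_range c" for x w
  proof -
    have L: "linear (\<lambda>a. ext_deriv \<omega> c x a w)" by (rule linear_ext_deriv[OF \<omega> c x])
    have "ext_deriv \<omega> c x (T c x) w = 0" using R c x by (simp add: reeb_field_def interior_prod_def)
    then show ?thesis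
      by (simp add: \<beta>_def interior_prod_def VV0[OF x] V0_def W_def \<alpha>_def
          linear_scale[OF L] linear_diff[OF L] linear_add[OF L])
  qed
  define P where "P x = k * D x + ((cos (k * h x))\<^sup>2 * Q u u x +
      cos (k * h x) * sin (k * h x) * (Q u v x + Q v u x) + (sin (k * h x))\<^sup>2 * Q v v x)" for x
  have dens: "wedge_density \<beta> c x = (\<phi> x)\<^sup>2 * P x" if x: "x \<in> chart_range c" for x
    unfolding P_def D_def Q_def e_def
    by (rule wedge_density_oscillating[where c = c and \<alpha>\<^sub>1 = "\<alpha> u" and \<alpha>\<^sub>2 = "\<alpha> v" and \<beta> = \<beta>,
          OF op x smooth_on_imp_differentiable[OF s\<phi> x] h])
      (rule s\<alpha> \<beta>, assumption?)+
  have P: "0 < s * P x" if x: "x \<in> ball p r" for x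
  proof -
    have "\<bar>D x - D p\<bar> < \<bar>D p\<bar> / 2" using r1(2)[of x] x by (simp add: r_def dist_commute)
    then have "\<bar>D p\<bar> / 2 \<le> sgn (D p) * D x" by (auto simp: sgn_if abs_if split: if_splits)
    then have "(2 * (M + 1) / \<bar>D p\<bar>) * (\<bar>D p\<bar> / 2) \<le> (2 * (M + 1) / \<bar>D p\<bar>) * (sgn (D p) * D x)"
      using \<open>0 \<le> M\<close> by (intro mult_left_mono) auto
    also have "\<dots> = s * (k * D x)" using sgn by (simp add: k_def)
    finally have 1: "M + 1 \<le> s * (k * D x)" using Dp by simp
    let ?R = "(cos (k * h x))\<^sup>2 * Q u u x + cos (k * h x) * sin (k * h x) * (Q u v x + Q v u x) +
      (sin (k * h x))\<^sup>2 * Q v v x"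
    have "\<bar>s * ?R\<bar> = \<bar>?R\<bar>" using s by (simp add: abs_mult)
    also have "\<dots> \<le> N x" unfolding N_def by (rule abs_trigonometric_form_le)
    also have "\<dots> \<le> M" using M[of x] x by auto
    finally have "\<bar>s * ?R\<bar> \<le> M" .
    then show ?thesis using 1 unfolding P_def distrib_left[of s "k * D x"] by linarith
  qed
  have nonneg_c: "0 \<le> s * wedge_density \<beta> c x" if x: "x \<in> chart_range c" for x
  proof (cases "x \<in> ball p r")
    case True
    have "0 \<le> (\<phi> x)\<^sup>2 * (s * P x)" using P[OF True] by simp
    then show ?thesis by (simp only: dens[OF x] mult.left_commute)
  next
    case False
    then have "\<phi> x = 0" using r by (simp add: \<phi>_def bump_eq_0_iff)
    then show ?thesis by (simp add: dens[OF x])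
  qed
  have nonneg: "0 \<le> s * wedge_density \<beta> d y" if d: "d \<in> A" and y: "y \<in> chart_range d" for d y
  proof (cases "y \<in> overlap d c")
    case True
    have "0 \<le> s * wedge_density \<beta> c (transition d c y)"
      using nonneg_c transition_in_overlap[OF d c True] by (simp add: overlap_iff[OF c])
    then have "0 \<le> det (matrix (transition_deriv d c y)) * (s * wedge_density \<beta> c (transition d c y))"
      by (rule mult_nonneg_nonneg[OF less_imp_le[OF transition_det_pos[OF d c True]]])
    then show ?thesis by (simp add: wedge_density_transition[OF \<beta>1 d c True] mult.left_commute)
  next
    case False
    then have "\<beta> d y w = 0" for w
      using linear_0[OF linear_ext_deriv[OF \<omega> d y]]
      by (simp add: \<beta>_def interior_prod_def V_def extend_field_def)
    then show ?thesis by (simp add: wedge_density_def wedge12_def)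
  qed
  have "0 < s * wedge_density \<beta> c p"
  proof -
    have "0 < (\<phi> p)\<^sup>2" using r by (simp add: \<phi>_def bump_eq_0_iff)
    moreover have "0 < s * P p" using P r by simp
    ultimately have "0 < (\<phi> p)\<^sup>2 * (s * P p)" by (rule mult_pos_pos)
    then show ?thesis by (simp only: dens[OF p] mult.left_commute)
  qed
  from integral_form_sign[OF \<beta>1 nonneg c p this]
  show ?thesis by (intro that[OF V \<omega>V]) (simp_all add: \<beta>_def)
qed

text \<open>The fields found for s = 1 and s = -1 make \<open>gv\<close> a positive and a negative
  multiple of t^2. The first rules out a local maximum, the second a local minimum. Nonemptiness
  provides the chart that carries the field.\<close>

lemma not_gv_local_extremum:
  assumes contact: "contact_form A \<omega>" and R: "reeb_field A \<omega> T" and ne: "topspace X \<noteq> {}"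
  shows "\<not> gv_local_extremum X A (ker_form \<omega>) T"
proof -
  have \<omega>: "one_form A \<omega>" using contact by (simp add: contact_form_def)
  have var: "\<exists>\<epsilon> \<omega>t Tt I. variation A (ker_form \<omega>) T \<epsilon> \<omega>t Tt \<and> 0 < s * I \<and>
      (\<forall>t. gv X A (ker_form (\<omega>t t)) (Tt t) = t\<^sup>2 * I)" if s: "\<bar>s\<bar> = (1::real)" for s
  proof (rule transverse_field_with_sign[OF contact R ne s])
    fix V
    define I where "I = integral_form X A (wedge12 (interior_prod V (ext_deriv \<omega>)) (ext_deriv (interior_prod V (ext_deriv \<omega>))))"
    assume V: "vector_field A V"
      "\<And>c x. c \<in> A \<Longrightarrow> x \<in> chart_range c \<Longrightarrow> \<omega> c x (V c x) = 0"
      "0 < s * integral_form X A (wedge12 (interior_prod V (ext_deriv \<omega>)) (ext_deriv (interior_prod V (ext_deriv \<omega>))))"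
    show ?thesis
    proof (rule exI[of _ 1], rule exI[of _ "\<lambda>_. \<omega>"], rule exI[of _ "\<lambda>t c x. T c x + t *\<^sub>R V c x"],
        rule exI[of _ I], intro conjI allI)
      show "variation A (ker_form \<omega>) T 1 (\<lambda>_. \<omega>) (\<lambda>t c x. T c x + t *\<^sub>R V c x)"
        by (rule variation_along_vector_field[OF \<omega> R V(1,2)])
      show "0 < s * I" using V(3) by (simp only: I_def)
      show "gv X A (ker_form \<omega>) (\<lambda>c x. T c x + t *\<^sub>R V c x) = t\<^sup>2 * I" for t
        unfolding I_def by (rule gv_along_vector_field[OF \<omega> R V(1,2)])
    qed
  qed
  \<comment> \<open>Serves both cases, with \<open>s = 1\<close> against a minimum and
    \<open>s = -1\<close> against a maximum; any small nonzero t, here \<open>d / 2\<close>, gives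
    the contradiction.\<close>
  have not_nonneg: False if ev: "\<forall>\<^sub>F t in nhds (0::real). 0 \<le> s * (t\<^sup>2 * I)" and neg: "s * I < 0" for s I :: real
  proof -
    obtain d where d: "d > 0" "\<And>t. dist t 0 < d \<Longrightarrow> 0 \<le> s * (t\<^sup>2 * I)"
      using ev unfolding eventually_nhds_metric by blast
    have "0 \<le> s * ((d / 2)\<^sup>2 * I)" by (rule d(2)) (use d(1) in simp)
    also have "\<dots> = (d / 2)\<^sup>2 * (s * I)" by (rule mult.left_commute)
    also have "\<dots> < 0" using d(1) by (intro mult_pos_neg[OF _ neg]) simp
    finally show False by simp
  qed
  show ?thesis
    unfolding gv_local_extremum_def
  proof (rule notI, erule disjE)
    assume min: "\<forall>\<epsilon> \<omega>t Tt. variation A (ker_form \<omega>) T \<epsilon> \<omega>t Tt \<longrightarrow>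
      local_min_at (\<lambda>t. gv X A (ker_form (\<omega>t t)) (Tt t)) 0"
    have "\<bar>- 1\<bar> = (1::real)" by simp
    from var[OF this] obtain \<epsilon> \<omega>t Tt I where I: "variation A (ker_form \<omega>) T \<epsilon> \<omega>t Tt" "0 < (- 1) * I"
      "\<forall>t. gv X A (ker_form (\<omega>t t)) (Tt t) = t\<^sup>2 * I"
      by (elim exE conjE)
    have "local_min_at (\<lambda>t. gv X A (ker_form (\<omega>t t)) (Tt t)) 0"
      by (rule min[rule_format, OF I(1)])
    then have "\<forall>\<^sub>F t in nhds 0. 0 \<le> 1 * (t\<^sup>2 * I)" by (simp add: local_min_at_def I(3)[rule_format])
    then show False by (rule not_nonneg) (use I(2) in simp)
  next
    assume max: "\<forall>\<epsilon> \<omega>t Tt. variation A (ker_form \<omega>) T \<epsilon> \<omega>t Tt \<longrightarrow>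
      local_max_at (\<lambda>t. gv X A (ker_form (\<omega>t t)) (Tt t)) 0"
    have "\<bar>1\<bar> = (1::real)" by simp
    from var[OF this] obtain \<epsilon> \<omega>t Tt I where I: "variation A (ker_form \<omega>) T \<epsilon> \<omega>t Tt" "0 < 1 * I"
      "\<forall>t. gv X A (ker_form (\<omega>t t)) (Tt t) = t\<^sup>2 * I"
      by (elim exE conjE)
    have "local_max_at (\<lambda>t. gv X A (ker_form (\<omega>t t)) (Tt t)) 0"
      by (rule max[rule_format, OF I(1)])
    then have "\<forall>\<^sub>F t in nhds 0. 0 \<le> - 1 * (t\<^sup>2 * I)" by (simp add: local_max_at_def I(3)[rule_format])
    then show False by (rule not_nonneg) (use I(2) in simp)
  qed
qed

end

theorem theorem2:
  fixes X :: "'a topology" and A :: "'a chart set"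
    and \<omega> :: "'a form1" and T :: "'a vec_field"
  assumes "closed_oriented_3manifold X A"
    and "topspace X \<noteq> {}"
    and "contact_form A \<omega>"
    and "reeb_field A \<omega> T"
  shows "gv_critical X A (ker_form \<omega>) T \<and> \<not> gv_local_extremum X A (ker_form \<omega>) T"
proof -
  interpret closed_manifold X A by unfold_locales (rule assms(1))
  have "one_form A \<omega>" using assms(3) by (simp add: contact_form_def)
  then show ?thesis
    using gv_critical_of_reeb_field not_gv_local_extremum assms(2-4) by blast
qed

end
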